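(* Let $\omega\in\Omega$ be an infinite real orbit with $B_\omega=\emptyset$, and let $V=V(\omega)$. Then $V^\sharp\simeq V$ as $A$-modules, and hence $V$ is pseudo-unitarizable.
   Context: Setup. $R$ is a commutative ring with $1$; $*:R\to R$ is a ring automorphism of order $1$ or $2$; $\sigma:R\to R$ is a ring automorphism commuting with $*$; $t\in R$ satisfies $t^*=t$. The generalized Weyl algebra $A=R(\sigma,t)$ is the ring generated by $R\cup\{X,Y\}$ such that $R$ is a subring and $YX=t$, $XY=\sigma(t)$, $Xr=\sigma(r)X$, $Yr=\sigma^{-1}(r)Y$ for all $r\in R$. It is $\mathbb Z$-graded with $\deg X=1$, $\deg Y=-1$, $\deg r=0$ for $r\in R$. The map $*$ extends to an involution of $A$ (additive, $(ab)^*=b^*a^*$, $a^{**}=a$) with $X^*=Y$, $Y^*=X$. $\Omega$ is the set of orbits of $\sigma$ acting on $\mathrm{Max}(R)$. An orbit $\omega$ is real if $\mathfrak m^*=\mathfrak m$ for all $\mathfrak m\in\omega$. $B_\omega=\{\mathfrak m\in\omega:t\in\mathfrak m\}$ is the set of breaks. $\mathbb K_{\mathfrak m}=R/\mathfrak m$, and $r_{\mathfrak m}=r+\mathfrak m$ for $r\in R$. $R_\omega=\bigoplus_{\mathfrak m\in\omega}R/\mathfrak m$; $\sigma$ induces isomorphisms $R/\mathfrak m\to R/\sigma(\mathfrak m)$ and an additive map $\sigma:R_\omega\to R_\omega$. A weight module is an $A$-module $V=\bigoplus_{\mathfrak m\in\mathrm{Max}(R)}V_{\mathfrak m}$ with $V_{\mathfrak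 m}=\{v:\mathfrak m v=0\}$; $\mathrm{Supp}(V)=\{\mathfrak m:V_{\mathfrak m}\ne0\}$. For a weight module $V$ with $\mathrm{Supp}(V)\subseteq\omega$: an admissible form on $V$ is a map $F:V\times V\to R_\omega$, additive in each argument, with $F(rv,w)=rF(v,w)$ for $r\in R$ and $F(av,w)=\sigma^{\deg a}(F(v,a^*w))$ for homogeneous $a\in A$. It is non-degenerate if for any nonzero $v$ there are $w_1,w_2$ with $F(w_1,v)\ne0\ne F(v,w_2)$. $V$ is pseudo-unitarizable if it has a non-degenerate admissible form. The finitistic dual $V^\sharp$ is the set of additive maps $\varphi:V\to R_\omega$ with $\varphi(rv)=r^*\varphi(v)$ and $\varphi(V_{\mathfrak m})=0$ for all but finitely many $\mathfrak m\in\omega$, an $A$-module via $(r\varphi)(v)=\varphi(r^*v)$, $(X\varphi)(v)=\sigma(\varphi(Yv))$, $(Y\varphi)(v)=\sigma^{-1}(\varphi(Xv))$. The module $V(\omega)$ (for $\omega$ infinite with $B_\omega=\emptyset$) is $V(\omega)=\bigoplus_{\mathfrak m\in\omega}\mathbb K_{\mathfrak m}$ with the natural $R$-action and $Xv=\sigma(t_{\mathfrak m}v)$, $Yv=\sigma^{-1}(v)$ for $v\in\mathbb K_{\mathfrak m}$. *)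

theory Defs
  imports "HOL-Algebra.Algebra"
begin

section \<open>The data of a generalized Weyl algebra with involution\<close>

locale gwa_datum = cring R for R :: "('r, 'x) ring_scheme" (structure) +
  fixes star :: "'r \<Rightarrow> 'r" and \<sigma> :: "'r \<Rightarrow> 'r" and t :: 'r
  assumes star_iso: "star \<in> ring_iso R R"
    and star_star: "r \<in> carrier R \<Longrightarrow> star (star r) = r"
    and sigma_iso: "\<sigma> \<in> ring_iso R R"
    and sigma_star: "r \<in> carrier R \<Longrightarrow> \<sigma> (star r) = star (\<sigma> r)"
    and t_closed: "t \<in> carrier R"
    and star_t: "star t = t"

text \<open>Integer powers of a bijection of \<open>S\<close> onto itself.\<close>

definition bij_pow :: "'a set \<Rightarrow> ('a \<Rightarrow> 'a) \<Rightarrow> int \<Rightarrow> 'a \<Rightarrow> 'a" where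
  "bij_pow S f n = (if 0 \<le> n then f ^^ nat n else inv_into S f ^^ nat (- n))"


section \<open>The generalized Weyl algebra\<close>

text \<open>The algebra is the ring presented by the generators \<open>R \<union> {X, Y}\<close>: ring expressions in these
  generators modulo the least ring congruence that contains the operations of \<open>R\<close> and the
  defining relations.  That \<open>R\<close> embeds as a subring is the lemma \<open>gwa_coef_inj\<close> below.\<close>

datatype 'r gwa_term =
    GCoef 'r
  | GX
  | GY
  | GAdd "'r gwa_term" "'r gwa_term"
  | GNeg "'r gwa_term"
  | GMul "'r gwa_term" "'r gwa_term"

inductive_set gwa_terms :: "('r, 'x) ring_scheme \<Rightarrow> 'r gwa_term set"
  for R :: "('r, 'x) ring_scheme" where
  coef: "r \<in> carrier R \<Longrightarrow> GCoef r \<in> gwa_terms R"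
| X: "GX \<in> gwa_terms R"
| Y: "GY \<in> gwa_terms R"
| add: "a \<in> gwa_terms R \<Longrightarrow> b \<in> gwa_terms R \<Longrightarrow> GAdd a b \<in> gwa_terms R"
| neg: "a \<in> gwa_terms R \<Longrightarrow> GNeg a \<in> gwa_terms R"
| mul: "a \<in> gwa_terms R \<Longrightarrow> b \<in> gwa_terms R \<Longrightarrow> GMul a b \<in> gwa_terms R"

inductive gwa_eq ::
  "('r, 'x) ring_scheme \<Rightarrow> ('r \<Rightarrow> 'r) \<Rightarrow> 'r \<Rightarrow> 'r gwa_term \<Rightarrow> 'r gwa_term \<Rightarrow> bool"
  for R :: "('r, 'x) ring_scheme" and \<sigma> :: "'r \<Rightarrow> 'r" and t :: 'r where
  refl: "a \<in> gwa_terms R \<Longrightarrow> gwa_eq R \<sigma> t a a"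
| sym: "gwa_eq R \<sigma> t a b \<Longrightarrow> gwa_eq R \<sigma> t b a"
| trans: "gwa_eq R \<sigma> t a b \<Longrightarrow> gwa_eq R \<sigma> t b c \<Longrightarrow> gwa_eq R \<sigma> t a c"
| add_cong: "gwa_eq R \<sigma> t a a' \<Longrightarrow> gwa_eq R \<sigma> t b b' \<Longrightarrow> gwa_eq R \<sigma> t (GAdd a b) (GAdd a' b')"
| neg_cong: "gwa_eq R \<sigma> t a a' \<Longrightarrow> gwa_eq R \<sigma> t (GNeg a) (GNeg a')"
| mul_cong: "gwa_eq R \<sigma> t a a' \<Longrightarrow> gwa_eq R \<sigma> t b b' \<Longrightarrow> gwa_eq R \<sigma> t (GMul a b) (GMul a' b')"
  (* ring axioms *)
| add_assoc: "a \<in> gwa_terms R \<Longrightarrow> b \<in> gwa_terms R \<Longrightarrow> c \<in> gwa_terms R \<Longrightarrow>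
    gwa_eq R \<sigma> t (GAdd (GAdd a b) c) (GAdd a (GAdd b c))"
| add_comm: "a \<in> gwa_terms R \<Longrightarrow> b \<in> gwa_terms R \<Longrightarrow> gwa_eq R \<sigma> t (GAdd a b) (GAdd b a)"
| add_zero: "a \<in> gwa_terms R \<Longrightarrow> gwa_eq R \<sigma> t (GAdd (GCoef \<zero>\<^bsub>R\<^esub>) a) a"
| add_neg: "a \<in> gwa_terms R \<Longrightarrow> gwa_eq R \<sigma> t (GAdd (GNeg a) a) (GCoef \<zero>\<^bsub>R\<^esub>)"
| mul_assoc: "a \<in> gwa_terms R \<Longrightarrow> b \<in> gwa_terms R \<Longrightarrow> c \<in> gwa_terms R \<Longrightarrow>
    gwa_eq R \<sigma> t (GMul (GMul a b) c) (GMul a (GMul b c))"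
| one_mul: "a \<in> gwa_terms R \<Longrightarrow> gwa_eq R \<sigma> t (GMul (GCoef \<one>\<^bsub>R\<^esub>) a) a"
| mul_one: "a \<in> gwa_terms R \<Longrightarrow> gwa_eq R \<sigma> t (GMul a (GCoef \<one>\<^bsub>R\<^esub>)) a"
| distrib_right: "a \<in> gwa_terms R \<Longrightarrow> b \<in> gwa_terms R \<Longrightarrow> c \<in> gwa_terms R \<Longrightarrow>
    gwa_eq R \<sigma> t (GMul (GAdd a b) c) (GAdd (GMul a c) (GMul b c))"
| distrib_left: "a \<in> gwa_terms R \<Longrightarrow> b \<in> gwa_terms R \<Longrightarrow> c \<in> gwa_terms R \<Longrightarrow>
    gwa_eq R \<sigma> t (GMul c (GAdd a b)) (GAdd (GMul c a) (GMul c b))"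
  (* the operations of R *)
| coef_add: "r \<in> carrier R \<Longrightarrow> s \<in> carrier R \<Longrightarrow>
    gwa_eq R \<sigma> t (GAdd (GCoef r) (GCoef s)) (GCoef (r \<oplus>\<^bsub>R\<^esub> s))"
| coef_mul: "r \<in> carrier R \<Longrightarrow> s \<in> carrier R \<Longrightarrow>
    gwa_eq R \<sigma> t (GMul (GCoef r) (GCoef s)) (GCoef (r \<otimes>\<^bsub>R\<^esub> s))"
  (* the defining relations *)
| YX: "gwa_eq R \<sigma> t (GMul GY GX) (GCoef t)"
| XY: "gwa_eq R \<sigma> t (GMul GX GY) (GCoef (\<sigma> t))"
| X_coef: "r \<in> carrier R \<Longrightarrow> gwa_eq R \<sigma> t (GMul GX (GCoef r)) (GMul (GCoef (\<sigma> r)) GX)"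
| Y_coef: "r \<in> carrier R \<Longrightarrow>
    gwa_eq R \<sigma> t (GMul GY (GCoef r)) (GMul (GCoef (inv_into (carrier R) \<sigma> r)) GY)"

definition gwa_class ::
  "('r, 'x) ring_scheme \<Rightarrow> ('r \<Rightarrow> 'r) \<Rightarrow> 'r \<Rightarrow> 'r gwa_term \<Rightarrow> 'r gwa_term set" where
  "gwa_class R \<sigma> t a = {b. gwa_eq R \<sigma> t a b}"

definition gwa ::
  "('r, 'x) ring_scheme \<Rightarrow> ('r \<Rightarrow> 'r) \<Rightarrow> 'r \<Rightarrow> 'r gwa_term set ring" where
  "gwa R \<sigma> t =
    \<lparr>carrier = gwa_class R \<sigma> t ` gwa_terms R,
     monoid.mult = (\<lambda>C D. \<Union>a\<in>C. \<Union>b\<in>D. gwa_class R \<sigma> t (GMul a b)),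
     one = gwa_class R \<sigma> t (GCoef \<one>\<^bsub>R\<^esub>),
     ring.zero = gwa_class R \<sigma> t (GCoef \<zero>\<^bsub>R\<^esub>),
     ring.add = (\<lambda>C D. \<Union>a\<in>C. \<Union>b\<in>D. gwa_class R \<sigma> t (GAdd a b))\<rparr>"

definition gwa_coef :: "('r, 'x) ring_scheme \<Rightarrow> ('r \<Rightarrow> 'r) \<Rightarrow> 'r \<Rightarrow> 'r \<Rightarrow> 'r gwa_term set" where
  "gwa_coef R \<sigma> t r = gwa_class R \<sigma> t (GCoef r)"

definition gwa_X :: "('r, 'x) ring_scheme \<Rightarrow> ('r \<Rightarrow> 'r) \<Rightarrow> 'r \<Rightarrow> 'r gwa_term set" where
  "gwa_X R \<sigma> t = gwa_class R \<sigma> t GX"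

definition gwa_Y :: "('r, 'x) ring_scheme \<Rightarrow> ('r \<Rightarrow> 'r) \<Rightarrow> 'r \<Rightarrow> 'r gwa_term set" where
  "gwa_Y R \<sigma> t = gwa_class R \<sigma> t GY"

text \<open>The grading: the component of degree \<open>d\<close> consists of the classes of those expressions that
  are homogeneous of degree \<open>d\<close> when \<open>deg X = 1\<close>, \<open>deg Y = -1\<close> and \<open>deg r = 0\<close>.\<close>

inductive gwa_homogeneous :: "('r, 'x) ring_scheme \<Rightarrow> int \<Rightarrow> 'r gwa_term \<Rightarrow> bool"
  for R :: "('r, 'x) ring_scheme" where
  coef: "r \<in> carrier R \<Longrightarrow> gwa_homogeneous R 0 (GCoef r)"
| X: "gwa_homogeneous R 1 GX"
| Y: "gwa_homogeneous R (- 1) GY"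
| add: "gwa_homogeneous R d a \<Longrightarrow> gwa_homogeneous R d b \<Longrightarrow> gwa_homogeneous R d (GAdd a b)"
| neg: "gwa_homogeneous R d a \<Longrightarrow> gwa_homogeneous R d (GNeg a)"
| mul: "gwa_homogeneous R d a \<Longrightarrow> gwa_homogeneous R e b \<Longrightarrow> gwa_homogeneous R (d + e) (GMul a b)"

definition gwa_component ::
  "('r, 'x) ring_scheme \<Rightarrow> ('r \<Rightarrow> 'r) \<Rightarrow> 'r \<Rightarrow> int \<Rightarrow> 'r gwa_term set set" where
  "gwa_component R \<sigma> t d = gwa_class R \<sigma> t ` {a. gwa_homogeneous R d a}"

text \<open>The anti-automorphism extending \<open>star\<close> and exchanging \<open>X\<close> and \<open>Y\<close>.\<close>

primrec gwa_term_star :: "('r \<Rightarrow> 'r) \<Rightarrow> 'r gwa_term \<Rightarrow> 'r gwa_term" where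
  "gwa_term_star star (GCoef r) = GCoef (star r)"
| "gwa_term_star star GX = GY"
| "gwa_term_star star GY = GX"
| "gwa_term_star star (GAdd a b) = GAdd (gwa_term_star star a) (gwa_term_star star b)"
| "gwa_term_star star (GNeg a) = GNeg (gwa_term_star star a)"
| "gwa_term_star star (GMul a b) = GMul (gwa_term_star star b) (gwa_term_star star a)"

definition gwa_star ::
  "('r, 'x) ring_scheme \<Rightarrow> ('r \<Rightarrow> 'r) \<Rightarrow> ('r \<Rightarrow> 'r) \<Rightarrow> 'r \<Rightarrow> 'r gwa_term set \<Rightarrow> 'r gwa_term set" where
  "gwa_star R star \<sigma> t C = (\<Union>a\<in>C. gwa_class R \<sigma> t (gwa_term_star star a))"


section \<open>Modules over a noncommutative ring\<close>

text \<open>The library's \<open>module\<close> requires a commutative ring of scalars; its record type is reused here,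
  with the fields \<open>mult\<close> and \<open>one\<close> left unused.\<close>

locale left_module = A?: ring A + V?: abelian_group V
  for A :: "('a, 'x) ring_scheme" (structure) and V :: "('a, 'v, 'y) module_scheme" (structure) +
  assumes smult_closed: "\<lbrakk>a \<in> carrier A; v \<in> carrier V\<rbrakk> \<Longrightarrow> a \<odot>\<^bsub>V\<^esub> v \<in> carrier V"
    and smult_add_left: "\<lbrakk>a \<in> carrier A; b \<in> carrier A; v \<in> carrier V\<rbrakk> \<Longrightarrow>
      (a \<oplus>\<^bsub>A\<^esub> b) \<odot>\<^bsub>V\<^esub> v = a \<odot>\<^bsub>V\<^esub> v \<oplus>\<^bsub>V\<^esub> b \<odot>\<^bsub>V\<^esub> v"
    and smult_add_right: "\<lbrakk>a \<in> carrier A; v \<in> carrier V; w \<in> carrier V\<rbrakk> \<Longrightarrow>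
      a \<odot>\<^bsub>V\<^esub> (v \<oplus>\<^bsub>V\<^esub> w) = a \<odot>\<^bsub>V\<^esub> v \<oplus>\<^bsub>V\<^esub> a \<odot>\<^bsub>V\<^esub> w"
    and smult_assoc: "\<lbrakk>a \<in> carrier A; b \<in> carrier A; v \<in> carrier V\<rbrakk> \<Longrightarrow>
      (a \<otimes>\<^bsub>A\<^esub> b) \<odot>\<^bsub>V\<^esub> v = a \<odot>\<^bsub>V\<^esub> (b \<odot>\<^bsub>V\<^esub> v)"
    and smult_one: "v \<in> carrier V \<Longrightarrow> \<one>\<^bsub>A\<^esub> \<odot>\<^bsub>V\<^esub> v = v"

definition left_module_isomorphic ::
  "('a, 'x) ring_scheme \<Rightarrow> ('a, 'v, 'y) module_scheme \<Rightarrow> ('a, 'w, 'z) module_scheme \<Rightarrow> bool" where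
  "left_module_isomorphic A V W \<longleftrightarrow> left_module A V \<and> left_module A W \<and>
    (\<exists>f. bij_betw f (carrier V) (carrier W) \<and>
      (\<forall>v\<in>carrier V. \<forall>w\<in>carrier V. f (v \<oplus>\<^bsub>V\<^esub> w) = f v \<oplus>\<^bsub>W\<^esub> f w) \<and>
      (\<forall>a\<in>carrier A. \<forall>v\<in>carrier V. f (a \<odot>\<^bsub>V\<^esub> v) = a \<odot>\<^bsub>W\<^esub> f v))"

text \<open>An \<open>R\<close>-module \<open>M\<close> with operators \<open>fX\<close> and \<open>fY\<close> through which \<open>X\<close> and \<open>Y\<close> act.  An element of the
  algebra acts through any expression representing it; by \<open>gwa_module_left_module\<close> below this is
  well defined as soon as \<open>fX\<close> and \<open>fY\<close> are additive and satisfy the defining relations.\<close>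

primrec gwa_eval ::
  "('r, 'v, 'y) module_scheme \<Rightarrow> ('v \<Rightarrow> 'v) \<Rightarrow> ('v \<Rightarrow> 'v) \<Rightarrow> 'r gwa_term \<Rightarrow> 'v \<Rightarrow> 'v" where
  "gwa_eval M fX fY (GCoef r) v = r \<odot>\<^bsub>M\<^esub> v"
| "gwa_eval M fX fY GX v = fX v"
| "gwa_eval M fX fY GY v = fY v"
| "gwa_eval M fX fY (GAdd a b) v = gwa_eval M fX fY a v \<oplus>\<^bsub>M\<^esub> gwa_eval M fX fY b v"
| "gwa_eval M fX fY (GNeg a) v = \<ominus>\<^bsub>M\<^esub> gwa_eval M fX fY a v"
| "gwa_eval M fX fY (GMul a b) v = gwa_eval M fX fY a (gwa_eval M fX fY b v)"

definition gwa_module ::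
  "('r, 'v, 'y) module_scheme \<Rightarrow> ('v \<Rightarrow> 'v) \<Rightarrow> ('v \<Rightarrow> 'v) \<Rightarrow> ('r gwa_term set, 'v) module" where
  "gwa_module M fX fY =
    \<lparr>carrier = carrier M, monoid.mult = undefined, one = undefined,
     ring.zero = \<zero>\<^bsub>M\<^esub>, ring.add = (\<oplus>\<^bsub>M\<^esub>),
     smult = (\<lambda>C v. the_elem ((\<lambda>a. gwa_eval M fX fY a v) ` C))\<rparr>"


section \<open>Orbits and the additive group \<open>R\<^sub>\<omega>\<close>\<close>

definition max_spec :: "('r, 'x) ring_scheme \<Rightarrow> 'r set set" where
  "max_spec R = {\<mm>. maximalideal \<mm> R}"

definition max_orbits :: "('r, 'x) ring_scheme \<Rightarrow> ('r \<Rightarrow> 'r) \<Rightarrow> 'r set set set" where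
  "max_orbits R \<sigma> = (\<lambda>\<mm>. {bij_pow (carrier R) \<sigma> n ` \<mm> | n. True}) ` max_spec R"

definition real_orbit :: "('r \<Rightarrow> 'r) \<Rightarrow> 'r set set \<Rightarrow> bool" where
  "real_orbit star \<omega> \<longleftrightarrow> (\<forall>\<mm>\<in>\<omega>. star ` \<mm> = \<mm>)"

definition breaks :: "'r \<Rightarrow> 'r set set \<Rightarrow> 'r set set" where
  "breaks t \<omega> = {\<mm> \<in> \<omega>. t \<in> \<mm>}"

text \<open>\<open>R\<^sub>\<omega>\<close> is the direct sum of the residue fields, with its natural \<open>R\<close>-module structure.\<close>

definition orbit_sum ::
  "('r, 'x) ring_scheme \<Rightarrow> 'r set set \<Rightarrow> ('r, 'r set \<Rightarrow> 'r set) module" where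
  "orbit_sum R \<omega> =
    \<lparr>carrier = carrier (sum_group \<omega> (\<lambda>\<mm>. add_monoid (R Quot \<mm>))),
     monoid.mult = undefined, one = undefined,
     ring.zero = (\<lambda>\<mm>\<in>\<omega>. \<zero>\<^bsub>R Quot \<mm>\<^esub>),
     ring.add = (\<lambda>u v. \<lambda>\<mm>\<in>\<omega>. u \<mm> \<oplus>\<^bsub>R Quot \<mm>\<^esub> v \<mm>),
     smult = (\<lambda>r u. \<lambda>\<mm>\<in>\<omega>. (\<mm> +>\<^bsub>R\<^esub> r) \<otimes>\<^bsub>R Quot \<mm>\<^esub> u \<mm>)\<rparr>"

text \<open>The isomorphism \<open>R/\<mm> \<rightarrow> R/\<sigma>(\<mm>)\<close> induced by \<open>\<sigma>\<close> sends a coset to its image under \<open>\<sigma>\<close>; hence the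
  component at \<open>\<mm>\<close> of the value of \<open>\<sigma>\<close> comes from the component at \<open>\<sigma>\<^sup>-\<^sup>1(\<mm>)\<close> of the argument.\<close>

definition orbit_sigma ::
  "('r, 'x) ring_scheme \<Rightarrow> ('r \<Rightarrow> 'r) \<Rightarrow> 'r set set \<Rightarrow> ('r set \<Rightarrow> 'r set) \<Rightarrow> 'r set \<Rightarrow> 'r set" where
  "orbit_sigma R \<sigma> \<omega> u = (\<lambda>\<mm>\<in>\<omega>. \<sigma> ` u (inv_into (carrier R) \<sigma> ` \<mm>))"

definition orbit_sigma_inv ::
  "('r, 'x) ring_scheme \<Rightarrow> ('r \<Rightarrow> 'r) \<Rightarrow> 'r set set \<Rightarrow> ('r set \<Rightarrow> 'r set) \<Rightarrow> 'r set \<Rightarrow> 'r set" where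
  "orbit_sigma_inv R \<sigma> \<omega> = inv_into (carrier (orbit_sum R \<omega>)) (orbit_sigma R \<sigma> \<omega>)"

definition orbit_sigma_pow ::
  "('r, 'x) ring_scheme \<Rightarrow> ('r \<Rightarrow> 'r) \<Rightarrow> 'r set set \<Rightarrow> int \<Rightarrow>
    ('r set \<Rightarrow> 'r set) \<Rightarrow> 'r set \<Rightarrow> 'r set" where
  "orbit_sigma_pow R \<sigma> \<omega> = bij_pow (carrier (orbit_sum R \<omega>)) (orbit_sigma R \<sigma> \<omega>)"


section \<open>Weight modules, admissible forms and the finitistic dual\<close>

definition weight_space ::
  "('r, 'x) ring_scheme \<Rightarrow> ('r \<Rightarrow> 'r) \<Rightarrow> 'r \<Rightarrow> ('r gwa_term set, 'v, 'y) module_scheme \<Rightarrow>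
    'r set \<Rightarrow> 'v set" where
  "weight_space R \<sigma> t V \<mm> = {v \<in> carrier V. \<forall>r\<in>\<mm>. gwa_coef R \<sigma> t r \<odot>\<^bsub>V\<^esub> v = \<zero>\<^bsub>V\<^esub>}"

text \<open>Direct sum decomposition: every vector is, in exactly one way, the sum of a finitely supported
  family of weight vectors.\<close>

definition weight_module ::
  "('r, 'x) ring_scheme \<Rightarrow> ('r \<Rightarrow> 'r) \<Rightarrow> 'r \<Rightarrow> ('r gwa_term set, 'v, 'y) module_scheme \<Rightarrow> bool" where
  "weight_module R \<sigma> t V \<longleftrightarrow> left_module (gwa R \<sigma> t) V \<and>
    (\<forall>v\<in>carrier V. \<exists>!c. c \<in> (\<Pi>\<^sub>E \<mm>\<in>max_spec R. weight_space R \<sigma> t V \<mm>) \<and>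
      finite {\<mm> \<in> max_spec R. c \<mm> \<noteq> \<zero>\<^bsub>V\<^esub>} \<and>
      v = (\<Oplus>\<^bsub>V\<^esub>\<mm>\<in>{\<mm> \<in> max_spec R. c \<mm> \<noteq> \<zero>\<^bsub>V\<^esub>}. c \<mm>))"

definition weight_support ::
  "('r, 'x) ring_scheme \<Rightarrow> ('r \<Rightarrow> 'r) \<Rightarrow> 'r \<Rightarrow> ('r gwa_term set, 'v, 'y) module_scheme \<Rightarrow>
    'r set set" where
  "weight_support R \<sigma> t V = {\<mm> \<in> max_spec R. weight_space R \<sigma> t V \<mm> \<noteq> {\<zero>\<^bsub>V\<^esub>}}"

definition admissible_form ::
  "('r, 'x) ring_scheme \<Rightarrow> ('r \<Rightarrow> 'r) \<Rightarrow> ('r \<Rightarrow> 'r) \<Rightarrow> 'r \<Rightarrow> 'r set set \<Rightarrow>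
    ('r gwa_term set, 'v, 'y) module_scheme \<Rightarrow> ('v \<Rightarrow> 'v \<Rightarrow> 'r set \<Rightarrow> 'r set) \<Rightarrow> bool" where
  "admissible_form R star \<sigma> t \<omega> V F \<longleftrightarrow>
    (\<forall>v\<in>carrier V. \<forall>w\<in>carrier V. F v w \<in> carrier (orbit_sum R \<omega>)) \<and>
    (\<forall>v\<in>carrier V. \<forall>v'\<in>carrier V. \<forall>w\<in>carrier V.
      F (v \<oplus>\<^bsub>V\<^esub> v') w = F v w \<oplus>\<^bsub>orbit_sum R \<omega>\<^esub> F v' w) \<and>
    (\<forall>v\<in>carrier V. \<forall>w\<in>carrier V. \<forall>w'\<in>carrier V.
      F v (w \<oplus>\<^bsub>V\<^esub> w') = F v w \<oplus>\<^bsub>orbit_sum R \<omega>\<^esub> F v w') \<and>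
    (\<forall>r\<in>carrier R. \<forall>v\<in>carrier V. \<forall>w\<in>carrier V.
      F (gwa_coef R \<sigma> t r \<odot>\<^bsub>V\<^esub> v) w = r \<odot>\<^bsub>orbit_sum R \<omega>\<^esub> F v w) \<and>
    (\<forall>d. \<forall>a\<in>gwa_component R \<sigma> t d. \<forall>v\<in>carrier V. \<forall>w\<in>carrier V.
      F (a \<odot>\<^bsub>V\<^esub> v) w = orbit_sigma_pow R \<sigma> \<omega> d (F v (gwa_star R star \<sigma> t a \<odot>\<^bsub>V\<^esub> w)))"

definition nondegenerate_form ::
  "('r, 'x) ring_scheme \<Rightarrow> 'r set set \<Rightarrow> ('r gwa_term set, 'v, 'y) module_scheme \<Rightarrow>
    ('v \<Rightarrow> 'v \<Rightarrow> 'r set \<Rightarrow> 'r set) \<Rightarrow> bool" where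
  "nondegenerate_form R \<omega> V F \<longleftrightarrow>
    (\<forall>v\<in>carrier V. v \<noteq> \<zero>\<^bsub>V\<^esub> \<longrightarrow>
      (\<exists>w\<^sub>1\<in>carrier V. \<exists>w\<^sub>2\<in>carrier V.
        F w\<^sub>1 v \<noteq> \<zero>\<^bsub>orbit_sum R \<omega>\<^esub> \<and> F v w\<^sub>2 \<noteq> \<zero>\<^bsub>orbit_sum R \<omega>\<^esub>))"

definition pseudo_unitarizable ::
  "('r, 'x) ring_scheme \<Rightarrow> ('r \<Rightarrow> 'r) \<Rightarrow> ('r \<Rightarrow> 'r) \<Rightarrow> 'r \<Rightarrow> 'r set set \<Rightarrow>
    ('r gwa_term set, 'v, 'y) module_scheme \<Rightarrow> bool" where
  "pseudo_unitarizable R star \<sigma> t \<omega> V \<longleftrightarrow>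
    weight_module R \<sigma> t V \<and> weight_support R \<sigma> t V \<subseteq> \<omega> \<and>
    (\<exists>F. admissible_form R star \<sigma> t \<omega> V F \<and> nondegenerate_form R \<omega> V F)"

definition dual_carrier ::
  "('r, 'x) ring_scheme \<Rightarrow> ('r \<Rightarrow> 'r) \<Rightarrow> ('r \<Rightarrow> 'r) \<Rightarrow> 'r \<Rightarrow> 'r set set \<Rightarrow>
    ('r gwa_term set, 'v, 'y) module_scheme \<Rightarrow> ('v \<Rightarrow> 'r set \<Rightarrow> 'r set) set" where
  "dual_carrier R star \<sigma> t \<omega> V =
    {\<phi> \<in> carrier V \<rightarrow>\<^sub>E carrier (orbit_sum R \<omega>).
      (\<forall>v\<in>carrier V. \<forall>w\<in>carrier V. \<phi> (v \<oplus>\<^bsub>V\<^esub> w) = \<phi> v \<oplus>\<^bsub>orbit_sum R \<omega>\<^esub> \<phi> w) \<and>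
      (\<forall>r\<in>carrier R. \<forall>v\<in>carrier V.
        \<phi> (gwa_coef R \<sigma> t r \<odot>\<^bsub>V\<^esub> v) = star r \<odot>\<^bsub>orbit_sum R \<omega>\<^esub> \<phi> v) \<and>
      finite {\<mm> \<in> \<omega>. \<exists>v\<in>weight_space R \<sigma> t V \<mm>. \<phi> v \<noteq> \<zero>\<^bsub>orbit_sum R \<omega>\<^esub>}}"

definition finitistic_dual ::
  "('r, 'x) ring_scheme \<Rightarrow> ('r \<Rightarrow> 'r) \<Rightarrow> ('r \<Rightarrow> 'r) \<Rightarrow> 'r \<Rightarrow> 'r set set \<Rightarrow>
    ('r gwa_term set, 'v, 'y) module_scheme \<Rightarrow>
    ('r gwa_term set, 'v \<Rightarrow> 'r set \<Rightarrow> 'r set) module" where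
  "finitistic_dual R star \<sigma> t \<omega> V =
    gwa_module
      \<lparr>carrier = dual_carrier R star \<sigma> t \<omega> V, monoid.mult = undefined, one = undefined,
       ring.zero = (\<lambda>v\<in>carrier V. \<zero>\<^bsub>orbit_sum R \<omega>\<^esub>),
       ring.add = (\<lambda>\<phi> \<psi>. \<lambda>v\<in>carrier V. \<phi> v \<oplus>\<^bsub>orbit_sum R \<omega>\<^esub> \<psi> v),
       smult = (\<lambda>r \<phi>. \<lambda>v\<in>carrier V. \<phi> (gwa_coef R \<sigma> t (star r) \<odot>\<^bsub>V\<^esub> v))\<rparr>
      (\<lambda>\<phi>. \<lambda>v\<in>carrier V. orbit_sigma R \<sigma> \<omega> (\<phi> (gwa_Y R \<sigma> t \<odot>\<^bsub>V\<^esub> v)))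
      (\<lambda>\<phi>. \<lambda>v\<in>carrier V. orbit_sigma_inv R \<sigma> \<omega> (\<phi> (gwa_X R \<sigma> t \<odot>\<^bsub>V\<^esub> v)))"

text \<open>The module \<open>V(\<omega>)\<close>; its underlying \<open>R\<close>-module is \<open>R\<^sub>\<omega>\<close>.  On the summand at \<open>\<mm>\<close>, multiplication
  by \<open>t\<close> is multiplication by the residue class of \<open>t\<close>.\<close>

definition orbit_module ::
  "('r, 'x) ring_scheme \<Rightarrow> ('r \<Rightarrow> 'r) \<Rightarrow> 'r \<Rightarrow> 'r set set \<Rightarrow>
    ('r gwa_term set, 'r set \<Rightarrow> 'r set) module" where
  "orbit_module R \<sigma> t \<omega> =
    gwa_module (orbit_sum R \<omega>)
      (\<lambda>v. orbit_sigma R \<sigma> \<omega> (t \<odot>\<^bsub>orbit_sum R \<omega>\<^esub> v))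
      (orbit_sigma_inv R \<sigma> \<omega>)"



section \<open>The constructions are well defined\<close>

lemma gwa_eq_terms:
  assumes "gwa_datum R star \<sigma> t" "gwa_eq R \<sigma> t a b"
  shows "a \<in> gwa_terms R \<and> b \<in> gwa_terms R"
proof -
  interpret gwa_datum R star \<sigma> t by fact
  have bij: "bij_betw \<sigma> (carrier R) (carrier R)" using sigma_iso by (simp add: ring_iso_def)
  then have s: "\<And>r. r \<in> carrier R \<Longrightarrow> \<sigma> r \<in> carrier R"
    and i: "\<And>r. r \<in> carrier R \<Longrightarrow> inv_into (carrier R) \<sigma> r \<in> carrier R"
    by (auto simp: bij_betw_def inv_into_into)
  show ?thesis using assms(2)
    by induction (auto intro!: gwa_terms.intros simp: s i t_closed)
qed

lemma gwa_class_eqI: "gwa_eq R \<sigma> t a b \<Longrightarrow> gwa_class R \<sigma> t a = gwa_class R \<sigma> t b"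
  unfolding gwa_class_def by (auto intro: gwa_eq.sym gwa_eq.trans)

lemma gwa_class_eq_iff:
  assumes "gwa_datum R star \<sigma> t" "a \<in> gwa_terms R" "b \<in> gwa_terms R"
  shows "gwa_class R \<sigma> t a = gwa_class R \<sigma> t b \<longleftrightarrow> gwa_eq R \<sigma> t a b"
  using assms unfolding gwa_class_def
  by (auto intro: gwa_eq.refl gwa_eq.sym gwa_eq.trans)

lemma gwa_mult_class:
  assumes d: "gwa_datum R star \<sigma> t" and a: "a \<in> gwa_terms R" and b: "b \<in> gwa_terms R"
  shows "gwa_class R \<sigma> t a \<otimes>\<^bsub>gwa R \<sigma> t\<^esub> gwa_class R \<sigma> t b = gwa_class R \<sigma> t (GMul a b)"
proof -
  have "gwa_class R \<sigma> t (GMul a' b') = gwa_class R \<sigma> t (GMul a b)"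
    if "a' \<in> gwa_class R \<sigma> t a" "b' \<in> gwa_class R \<sigma> t b" for a' b'
    using that unfolding gwa_class_def[of _ _ _ a] gwa_class_def[of _ _ _ b]
    by (intro gwa_class_eqI gwa_eq.sym[OF gwa_eq.mul_cong]) auto
  moreover have "gwa_class R \<sigma> t a \<noteq> {}" "gwa_class R \<sigma> t b \<noteq> {}"
    using a b by (auto simp: gwa_class_def intro: gwa_eq.refl)
  ultimately have "(\<Union>a'\<in>gwa_class R \<sigma> t a. \<Union>b'\<in>gwa_class R \<sigma> t b. gwa_class R \<sigma> t (GMul a' b')) =
      gwa_class R \<sigma> t (GMul a b)"
    by (intro SUP_eq_const) auto
  then show ?thesis by (simp add: gwa_def)
qed

lemma gwa_add_class:
  assumes d: "gwa_datum R star \<sigma> t" and a: "a \<in> gwa_terms R" and b: "b \<in> gwa_terms R"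
  shows "gwa_class R \<sigma> t a \<oplus>\<^bsub>gwa R \<sigma> t\<^esub> gwa_class R \<sigma> t b = gwa_class R \<sigma> t (GAdd a b)"
proof -
  have "gwa_class R \<sigma> t (GAdd a' b') = gwa_class R \<sigma> t (GAdd a b)"
    if "a' \<in> gwa_class R \<sigma> t a" "b' \<in> gwa_class R \<sigma> t b" for a' b'
    using that unfolding gwa_class_def[of _ _ _ a] gwa_class_def[of _ _ _ b]
    by (intro gwa_class_eqI gwa_eq.sym[OF gwa_eq.add_cong]) auto
  moreover have "gwa_class R \<sigma> t a \<noteq> {}" "gwa_class R \<sigma> t b \<noteq> {}"
    using a b by (auto simp: gwa_class_def intro: gwa_eq.refl)
  ultimately have "(\<Union>a'\<in>gwa_class R \<sigma> t a. \<Union>b'\<in>gwa_class R \<sigma> t b. gwa_class R \<sigma> t (GAdd a' b')) =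
      gwa_class R \<sigma> t (GAdd a b)"
    by (intro SUP_eq_const) auto
  then show ?thesis by (simp add: gwa_def)
qed

lemma gwa_ring:
  assumes d: "gwa_datum R star \<sigma> t"
  shows "ring (gwa R \<sigma> t)"
proof -
  interpret gwa_datum R star \<sigma> t by fact
  let ?A = "gwa R \<sigma> t" and ?c = "gwa_class R \<sigma> t"
  have car: "carrier ?A = ?c ` gwa_terms R" and one: "\<one>\<^bsub>?A\<^esub> = ?c (GCoef \<one>\<^bsub>R\<^esub>)"
    and zero: "\<zero>\<^bsub>?A\<^esub> = ?c (GCoef \<zero>\<^bsub>R\<^esub>)"
    by (simp_all add: gwa_def)
  note op = gwa_mult_class[OF d] gwa_add_class[OF d]
  have z: "GCoef \<zero>\<^bsub>R\<^esub> \<in> gwa_terms R" "GCoef \<one>\<^bsub>R\<^esub> \<in> gwa_terms R" by (auto intro: gwa_terms.intros)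
  note ax = gwa_eq.add_assoc gwa_eq.add_comm gwa_eq.add_zero gwa_eq.mul_assoc gwa_eq.one_mul
    gwa_eq.mul_one gwa_eq.distrib_right gwa_eq.distrib_left
  show ?thesis
  proof (rule ringI)
    show "abelian_group ?A"
    proof (rule abelian_groupI)
      fix x assume "x \<in> carrier ?A"
      then obtain a where a: "a \<in> gwa_terms R" "x = ?c a" by (auto simp: car)
      then have "?c (GNeg a) \<in> carrier ?A" "?c (GNeg a) \<oplus>\<^bsub>?A\<^esub> x = \<zero>\<^bsub>?A\<^esub>"
        by (auto simp: car zero op z gwa_terms.intros intro!: gwa_class_eqI gwa_eq.add_neg)
      then show "\<exists>y\<in>carrier ?A. y \<oplus>\<^bsub>?A\<^esub> x = \<zero>\<^bsub>?A\<^esub>" by blast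
    qed (auto simp: car zero op z gwa_terms.intros intro!: gwa_class_eqI ax del: equalityI)
    show "Group.monoid ?A"
      by (rule monoidI) (auto simp: car one op z gwa_terms.intros intro!: gwa_class_eqI ax del: equalityI)
  qed (auto simp: car op gwa_terms.intros intro!: gwa_class_eqI ax del: equalityI)
qed

lemma gwa_term_star_terms:
  assumes "gwa_datum R star \<sigma> t" "a \<in> gwa_terms R"
  shows "gwa_term_star star a \<in> gwa_terms R \<and> gwa_term_star star (gwa_term_star star a) = a"
proof -
  interpret gwa_datum R star \<sigma> t by fact
  have c: "\<And>r. r \<in> carrier R \<Longrightarrow> star r \<in> carrier R"
    using star_iso by (auto simp: ring_iso_def bij_betw_def)
  show ?thesis using assms(2)
    by induction (auto intro!: gwa_terms.intros simp: star_star c)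
qed

lemma gwa_term_star_eq:
  fixes R :: "('r, 'x) ring_scheme" (structure)
  assumes d: "gwa_datum R star \<sigma> t" and e: "gwa_eq R \<sigma> t a b"
  shows "gwa_eq R \<sigma> t (gwa_term_star star a) (gwa_term_star star b)"
proof -
  interpret gwa_datum R star \<sigma> t by fact
  let ?i = "inv_into (carrier R) \<sigma>"
  have bij: "bij_betw \<sigma> (carrier R) (carrier R)" using sigma_iso by (simp add: ring_iso_def)
  then have s [simp]: "\<And>r. r \<in> carrier R \<Longrightarrow> \<sigma> r \<in> carrier R"
    and i [simp]: "\<And>r. r \<in> carrier R \<Longrightarrow> ?i r \<in> carrier R"
    and si: "\<And>r. r \<in> carrier R \<Longrightarrow> \<sigma> (?i r) = r"
    and iss: "\<And>r. r \<in> carrier R \<Longrightarrow> ?i (\<sigma> r) = r"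
    by (auto simp: bij_betw_def inv_into_into f_inv_into_f)
  have hom: "ring_hom_cring R R star" using star_iso
    by (auto simp: ring_iso_def intro!: ring_hom_cringI is_cring)
  have c [simp]: "\<And>r. r \<in> carrier R \<Longrightarrow> star r \<in> carrier R"
    using star_iso by (auto simp: ring_iso_def bij_betw_def)
  have z: "star \<zero> = \<zero>" "star \<one> = \<one>"
    "\<And>r s. r \<in> carrier R \<Longrightarrow> s \<in> carrier R \<Longrightarrow> star (r \<oplus> s) = star r \<oplus> star s"
    "\<And>r s. r \<in> carrier R \<Longrightarrow> s \<in> carrier R \<Longrightarrow> star (r \<otimes> s) = star s \<otimes> star r"
    using ring_hom_cring.hom_zero[OF hom] star_iso
    by (auto simp: ring_iso_def ring_hom_one ring_hom_add ring_hom_mult m_comm)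
  have T: "\<And>a. a \<in> gwa_terms R \<Longrightarrow> gwa_term_star star a \<in> gwa_terms R"
    using gwa_term_star_terms[OF d] by blast
  have si': "star (\<sigma> t) = \<sigma> t" using sigma_star[OF t_closed] star_t by simp
  show ?thesis using e
  proof induction
    case (X_coef r)
    have "gwa_eq R \<sigma> t (GMul GY (GCoef (star (\<sigma> r)))) (GMul (GCoef (?i (star (\<sigma> r)))) GY)"
      by (rule gwa_eq.Y_coef) (simp add: X_coef)
    moreover have "?i (star (\<sigma> r)) = star r"
      using sigma_star[OF X_coef] iss[of "star r"] X_coef by simp
    ultimately show ?case by (simp add: gwa_eq.sym)
  next
    case (Y_coef r)
    have "gwa_eq R \<sigma> t (GMul GX (GCoef (star (?i r)))) (GMul (GCoef (\<sigma> (star (?i r)))) GX)"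
      by (rule gwa_eq.X_coef) (simp add: Y_coef)
    moreover have "\<sigma> (star (?i r)) = star r"
      using sigma_star[of "?i r"] si Y_coef by simp
    ultimately show ?case by (simp add: gwa_eq.sym)
  next
    case (trans a b c)
    then show ?case by (blast intro: gwa_eq.trans)
  next
    case (mul_assoc a b c)
    then show ?case by (auto intro!: gwa_eq.sym[OF gwa_eq.mul_assoc] T)
  next
    case YX
    show ?case by (simp add: star_t gwa_eq.YX)
  next
    case XY
    show ?case by (simp add: si' gwa_eq.XY)
  next
    case (sym a b)
    then show ?case by (blast intro: gwa_eq.sym)
  next
    case (distrib_right a b c)
    then show ?case by (simp add: gwa_eq.distrib_left T)
  next
    case (add_assoc a b c)
    then show ?case by (simp add: gwa_eq.add_assoc T)
  next
    case (distrib_left a b c)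
    then show ?case by (simp add: gwa_eq.distrib_right T)
  qed (auto intro!: gwa_eq.refl gwa_eq.add_cong gwa_eq.neg_cong gwa_eq.mul_cong
      gwa_eq.add_comm gwa_eq.add_zero gwa_eq.add_neg gwa_eq.one_mul gwa_eq.mul_one
      gwa_eq.coef_add gwa_eq.coef_mul simp: z T)
qed

lemma gwa_star_class:
  assumes d: "gwa_datum R star \<sigma> t" and a: "a \<in> gwa_terms R"
  shows "gwa_star R star \<sigma> t (gwa_class R \<sigma> t a) = gwa_class R \<sigma> t (gwa_term_star star a)"
proof -
  have "gwa_class R \<sigma> t (gwa_term_star star b) = gwa_class R \<sigma> t (gwa_term_star star a)"
    if "b \<in> gwa_class R \<sigma> t a" for b
    using that unfolding gwa_class_def[of _ _ _ a]
    by (intro gwa_class_eqI gwa_eq.sym[OF gwa_term_star_eq[OF d]]) auto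
  moreover have "gwa_class R \<sigma> t a \<noteq> {}"
    using a by (auto simp: gwa_class_def intro: gwa_eq.refl)
  ultimately show ?thesis unfolding gwa_star_def by (intro SUP_eq_const) auto
qed

lemma gwa_star_involution:
  assumes d: "gwa_datum R star \<sigma> t" and "a \<in> carrier (gwa R \<sigma> t)" and "b \<in> carrier (gwa R \<sigma> t)"
  shows "gwa_star R star \<sigma> t (gwa_star R star \<sigma> t a) = a"
    and "gwa_star R star \<sigma> t (a \<oplus>\<^bsub>gwa R \<sigma> t\<^esub> b) =
      gwa_star R star \<sigma> t a \<oplus>\<^bsub>gwa R \<sigma> t\<^esub> gwa_star R star \<sigma> t b"
    and "gwa_star R star \<sigma> t (a \<otimes>\<^bsub>gwa R \<sigma> t\<^esub> b) =
      gwa_star R star \<sigma> t b \<otimes>\<^bsub>gwa R \<sigma> t\<^esub> gwa_star R star \<sigma> t a"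
proof -
  obtain a' b' where a: "a' \<in> gwa_terms R" "a = gwa_class R \<sigma> t a'"
    and b: "b' \<in> gwa_terms R" "b = gwa_class R \<sigma> t b'"
    using assms(2,3) by (auto simp: gwa_def)
  note st = gwa_term_star_terms[OF d a(1)] gwa_term_star_terms[OF d b(1)]
  show "gwa_star R star \<sigma> t (gwa_star R star \<sigma> t a) = a"
    using a st by (simp add: gwa_star_class[OF d])
  show "gwa_star R star \<sigma> t (a \<oplus>\<^bsub>gwa R \<sigma> t\<^esub> b) =
      gwa_star R star \<sigma> t a \<oplus>\<^bsub>gwa R \<sigma> t\<^esub> gwa_star R star \<sigma> t b"
    using a b st by (simp add: gwa_star_class[OF d] gwa_add_class[OF d] gwa_terms.add)
  show "gwa_star R star \<sigma> t (a \<otimes>\<^bsub>gwa R \<sigma> t\<^esub> b) =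
      gwa_star R star \<sigma> t b \<otimes>\<^bsub>gwa R \<sigma> t\<^esub> gwa_star R star \<sigma> t a"
    using a b st by (simp add: gwa_star_class[OF d] gwa_mult_class[OF d] gwa_terms.mul)
qed

lemma gwa_eval_eq:
  assumes d: "gwa_datum R star \<sigma> t" and M: "module R M"
    and X: "fX \<in> carrier M \<rightarrow> carrier M" and Y: "fY \<in> carrier M \<rightarrow> carrier M"
    and Xadd: "\<And>v w. v \<in> carrier M \<Longrightarrow> w \<in> carrier M \<Longrightarrow> fX (v \<oplus>\<^bsub>M\<^esub> w) = fX v \<oplus>\<^bsub>M\<^esub> fX w"
    and Yadd: "\<And>v w. v \<in> carrier M \<Longrightarrow> w \<in> carrier M \<Longrightarrow> fY (v \<oplus>\<^bsub>M\<^esub> w) = fY v \<oplus>\<^bsub>M\<^esub> fY w"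
    and YX: "\<And>v. v \<in> carrier M \<Longrightarrow> fY (fX v) = t \<odot>\<^bsub>M\<^esub> v"
    and XY: "\<And>v. v \<in> carrier M \<Longrightarrow> fX (fY v) = \<sigma> t \<odot>\<^bsub>M\<^esub> v"
    and Xr: "\<And>r v. r \<in> carrier R \<Longrightarrow> v \<in> carrier M \<Longrightarrow> fX (r \<odot>\<^bsub>M\<^esub> v) = \<sigma> r \<odot>\<^bsub>M\<^esub> fX v"
    and Yr: "\<And>r v. r \<in> carrier R \<Longrightarrow> v \<in> carrier M \<Longrightarrow>
      fY (r \<odot>\<^bsub>M\<^esub> v) = inv_into (carrier R) \<sigma> r \<odot>\<^bsub>M\<^esub> fY v"
  shows gwa_eval_closed: "\<And>a v. a \<in> gwa_terms R \<Longrightarrow> v \<in> carrier M \<Longrightarrow>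
      gwa_eval M fX fY a v \<in> carrier M"
    and gwa_eval_add: "\<And>a v w. a \<in> gwa_terms R \<Longrightarrow> v \<in> carrier M \<Longrightarrow> w \<in> carrier M \<Longrightarrow>
      gwa_eval M fX fY a (v \<oplus>\<^bsub>M\<^esub> w) = gwa_eval M fX fY a v \<oplus>\<^bsub>M\<^esub> gwa_eval M fX fY a w"
    and gwa_eval_cong: "\<And>a b v. gwa_eq R \<sigma> t a b \<Longrightarrow> v \<in> carrier M \<Longrightarrow>
      gwa_eval M fX fY a v = gwa_eval M fX fY b v"
    and gwa_module_left_module: "left_module (gwa R \<sigma> t) (gwa_module M fX fY)"
    and gwa_module_smult: "\<And>a v. a \<in> gwa_terms R \<Longrightarrow> v \<in> carrier M \<Longrightarrow>
      gwa_class R \<sigma> t a \<odot>\<^bsub>gwa_module M fX fY\<^esub> v = gwa_eval M fX fY a v"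
proof -
  interpret M: module R M by fact
  let ?e = "gwa_eval M fX fY" and ?c = "gwa_class R \<sigma> t" and ?V = "gwa_module M fX fY"
  show cl: "?e a v \<in> carrier M" if "a \<in> gwa_terms R" "v \<in> carrier M" for a v
    using that X Y by (induction arbitrary: v) auto
  show ad: "?e a (v \<oplus>\<^bsub>M\<^esub> w) = ?e a v \<oplus>\<^bsub>M\<^esub> ?e a w"
    if "a \<in> gwa_terms R" "v \<in> carrier M" "w \<in> carrier M" for a v w
    using that
  proof (induction arbitrary: v w)
    case (add a b)
    then show ?case by (simp add: cl M.add.m_ac)
  next
    case (neg a)
    then show ?case by (simp add: cl M.minus_add)
  qed (simp_all add: M.smult_r_distr Xadd Yadd cl)
  show eq: "?e a v = ?e b v" if "gwa_eq R \<sigma> t a b" "v \<in> carrier M" for a b v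
    using that
  proof (induction arbitrary: v)
    case (mul_cong a a' b b')
    then show ?case using gwa_eq_terms[OF d] cl by simp
  next
    case (add_assoc a b c)
    then show ?case by (simp add: cl M.add.m_assoc)
  next
    case (add_comm a b)
    then show ?case by (simp add: cl M.add.m_comm)
  next
    case (add_neg a)
    then show ?case by (simp add: cl M.l_neg M.smult_l_null)
  qed (auto simp: cl ad M.smult_l_null M.smult_l_distr M.smult_assoc1 YX XY Xr Yr)
  show sm: "?c a \<odot>\<^bsub>?V\<^esub> v = ?e a v" if a: "a \<in> gwa_terms R" and v: "v \<in> carrier M" for a v
  proof -
    have "(\<lambda>a. ?e a v) ` ?c a = {?e a v}"
      using eq[OF _ v] gwa_eq.refl[OF a] unfolding gwa_class_def by force
    then show ?thesis by (simp add: gwa_module_def)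
  qed
  have car: "carrier (gwa R \<sigma> t) = ?c ` gwa_terms R" and one: "\<one>\<^bsub>gwa R \<sigma> t\<^esub> = ?c (GCoef \<one>\<^bsub>R\<^esub>)"
    by (simp_all add: gwa_def)
  have V: "carrier ?V = carrier M" "ring.add ?V = ring.add M" "ring.zero ?V = ring.zero M"
    by (simp_all add: gwa_module_def)
  have ag: "abelian_group ?V"
    by (rule abelian_groupI)
      (auto simp: V M.add.m_ac intro: M.l_neg M.a_inv_closed)
  show "left_module (gwa R \<sigma> t) ?V"
    by (intro left_module.intro left_module_axioms.intro gwa_ring[OF d] ag)
      (auto simp: car one V sm cl ad gwa_terms.intros gwa_add_class[OF d] gwa_mult_class[OF d])
qed

text \<open>\<open>R\<close> embeds into the algebra: let it act on sequences indexed by the integers.\<close>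

lemma gwa_coef_inj:
  fixes R :: "('r, 'x) ring_scheme" (structure)
  assumes d: "gwa_datum R star \<sigma> t"
  shows "inj_on (gwa_coef R \<sigma> t) (carrier R)"
proof -
  interpret gwa_datum R star \<sigma> t by fact
  let ?i = "inv_into (carrier R) \<sigma>"
  have bij: "bij_betw \<sigma> (carrier R) (carrier R)" using sigma_iso by (simp add: ring_iso_def)
  then have s [simp]: "\<And>r. r \<in> carrier R \<Longrightarrow> \<sigma> r \<in> carrier R"
    and i [simp]: "\<And>r. r \<in> carrier R \<Longrightarrow> ?i r \<in> carrier R"
    and si [simp]: "\<And>r. r \<in> carrier R \<Longrightarrow> \<sigma> (?i r) = r"
    and iss [simp]: "\<And>r. r \<in> carrier R \<Longrightarrow> ?i (\<sigma> r) = r"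
    by (auto simp: bij_betw_def inv_into_into f_inv_into_f)
  have h [simp]: "\<And>r s. r \<in> carrier R \<Longrightarrow> s \<in> carrier R \<Longrightarrow> \<sigma> (r \<oplus> s) = \<sigma> r \<oplus> \<sigma> s"
    "\<And>r s. r \<in> carrier R \<Longrightarrow> s \<in> carrier R \<Longrightarrow> \<sigma> (r \<otimes> s) = \<sigma> r \<otimes> \<sigma> s"
    using sigma_iso by (auto simp: ring_iso_def ring_hom_def)
  have ih [simp]: "\<And>r s. r \<in> carrier R \<Longrightarrow> s \<in> carrier R \<Longrightarrow> ?i (r \<oplus> s) = ?i r \<oplus> ?i s"
    "\<And>r s. r \<in> carrier R \<Longrightarrow> s \<in> carrier R \<Longrightarrow> ?i (r \<otimes> s) = ?i r \<otimes> ?i s"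
  proof -
    fix r s assume rs: "r \<in> carrier R" "s \<in> carrier R"
    then have "r \<oplus> s = \<sigma> (?i r \<oplus> ?i s)" "r \<otimes> s = \<sigma> (?i r \<otimes> ?i s)" by simp_all
    then show "?i (r \<oplus> s) = ?i r \<oplus> ?i s" "?i (r \<otimes> s) = ?i r \<otimes> ?i s"
      using rs by (simp_all del: h)
  qed
  define M :: "('r, int \<Rightarrow> 'r) module" where
    "M = \<lparr>carrier = UNIV \<rightarrow> carrier R, monoid.mult = undefined, one = undefined,
      ring.zero = (\<lambda>_. \<zero>), ring.add = (\<lambda>f g n. f n \<oplus> g n), smult = (\<lambda>r f n. r \<otimes> f n)\<rparr>"
  have M: "carrier M = UNIV \<rightarrow> carrier R" "ring.zero M = (\<lambda>_. \<zero>)" "ring.add M = (\<lambda>f g n. f n \<oplus> g n)"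
    "smult M = (\<lambda>r f n. r \<otimes> f n)"
    by (simp_all add: M_def)
  have ag: "abelian_group M"
  proof (rule abelian_groupI)
    fix f assume "f \<in> carrier M"
    then show "\<exists>g\<in>carrier M. g \<oplus>\<^bsub>M\<^esub> f = \<zero>\<^bsub>M\<^esub>"
      by (intro bexI[of _ "\<lambda>n. \<ominus> f n"]) (auto simp: M Pi_iff l_neg)
  qed (auto simp: M Pi_iff add.m_ac)
  have mod: "module R M"
    by (intro module.intro is_cring ag module_axioms.intro)
      (auto simp: M Pi_iff l_distr r_distr m_assoc)
  define fX fY where "fX = (\<lambda>f (n::int). \<sigma> (t \<otimes> f (n - 1)))" and "fY = (\<lambda>f (n::int). ?i (f (n + 1)))"
  have sm: "gwa_class R \<sigma> t a \<odot>\<^bsub>gwa_module M fX fY\<^esub> v = gwa_eval M fX fY a v"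
    if "a \<in> gwa_terms R" "v \<in> carrier M" for a v
    by (rule gwa_module_smult[OF d mod _ _ _ _ _ _ _ _ that])
      (auto simp: M Pi_iff fX_def fY_def t_closed r_distr m_lcomm)
  show ?thesis
  proof (rule inj_onI)
    fix r s assume r: "r \<in> carrier R" and s: "s \<in> carrier R"
      and "gwa_coef R \<sigma> t r = gwa_coef R \<sigma> t s"
    then have "gwa_eval M fX fY (GCoef r) (\<lambda>_. \<one>) = gwa_eval M fX fY (GCoef s) (\<lambda>_. \<one>)"
      using sm[of "GCoef r" "\<lambda>_. \<one>"] sm[of "GCoef s" "\<lambda>_. \<one>"]
      by (simp add: gwa_coef_def gwa_terms.intros M)
    then have "(\<lambda>n::int. r \<otimes> \<one>) = (\<lambda>n. s \<otimes> \<one>)" by (simp add: M)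
    then show "r = s" using r s by (metis r_one)
  qed
qed

end

theory Submission
  imports Defs
begin

text \<open>A diagonal form \<open>F(v, w) = (c\<^sub>\<mm> v\<^sub>\<mm> w\<^sub>\<mm>\<^sup>*)\<^sub>\<mm>\<close> on \<open>V(\<omega>)\<close> is admissible iff
  \<open>c\<^bsub>\<sigma>(\<mm>)\<^esub> \<sigma>(t\<^sub>\<mm>) = \<sigma>(c\<^sub>\<mm>)\<close> for all \<open>\<mm> \<in> \<omega>\<close>.  As \<open>\<omega>\<close> is infinite it is a copy of \<open>\<int>\<close>, so this
  recursion never closes up, and as no \<open>t\<^sub>\<mm>\<close> vanishes it can be solved in both directions with all
  \<open>c\<^sub>\<mm>\<close> nonzero.  The resulting non-degenerate form yields the isomorphism \<open>u \<mapsto> F(u, \<cdot>)\<close> onto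
  the dual; surjectivity holds because a functional \<open>\<phi>\<close> in the dual is determined by the finitely
  many nonzero values \<open>\<phi>(1\<^sub>\<mm>)\<close>, each of which lies in the component at \<open>\<mm>\<^sup>* = \<mm>\<close>.\<close>

section \<open>Integer iteration and images of ideals\<close>

text \<open>A form that is linear in the first variable and star-linear in the second is just what
  makes u \<mapsto> F(u, -) an R-linear map into the finitistic dual. The dual is never checked to
  be an A-module by hand: once the operators X and Y correspond under this bijection, the module
  laws are carried over from V. Realness of the orbit permits the diagonal shape, since star then
  acts on every single residue field and the product of v and star w at one ideal makes sense. The
  conditions for X and for Y look like two recursions for the coefficients. There is only one: the
  condition for Y follows from that for X, because XY acts as \<sigma>(t) and \<sigma>(t) is fixed
  by star. The condition for an arbitrary homogeneous element then follows by induction on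
  expressions. The coefficients are not canonical. An admissible form carries no symmetry
  requirement, so any nonzero solution of the recursion is acceptable, whether fixed by star or not,
  and its value at one ideal can be chosen freely.\<close>

lemma
  assumes bij: "bij_betw f S S" and x: "x \<in> S"
  shows bij_pow_closed: "bij_pow S f n x \<in> S"
    and bij_pow_succ: "bij_pow S f (n + 1) x = f (bij_pow S f n x)"
    and bij_pow_pred: "bij_pow S f (n - 1) x = inv_into S f (bij_pow S f n x)"
proof -
  let ?g = "inv_into S f"
  have f: "y \<in> S \<Longrightarrow> f y \<in> S" and g: "y \<in> S \<Longrightarrow> ?g y \<in> S"
    and fg: "y \<in> S \<Longrightarrow> f (?g y) = y" and gf: "y \<in> S \<Longrightarrow> ?g (f y) = y" for y
    using bij by (auto simp: bij_betw_def inv_into_into f_inv_into_f)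
  have fp: "(f ^^ k) x \<in> S" and gp: "(?g ^^ k) x \<in> S" for k
    using x by (induction k) (auto simp: f g)
  show cl: "bij_pow S f n x \<in> S" for n
    by (simp add: bij_pow_def fp gp)
  show succ: "bij_pow S f (n + 1) x = f (bij_pow S f n x)" for n
  proof (cases "0 \<le> n")
    case True
    then show ?thesis by (simp add: bij_pow_def nat_add_distrib)
  next
    case False
    define k where "k = nat (- n - 1)"
    with False have "n = - int (Suc k)" by simp
    \<comment> \<open>The value n = -1 is split off because n + 1 = 0 already falls into the
      nonnegative branch of \<open>bij_pow\<close>.\<close>
    then show ?thesis by (cases k) (simp_all add: bij_pow_def nat_add_distrib fg g x gp)
  qed
  show "bij_pow S f (n - 1) x = ?g (bij_pow S f n x)"
    using succ[of "n - 1"] cl[of "n - 1"] by (simp add: gf)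
qed

lemma bij_pow_0 [simp]: "bij_pow S f 0 x = x"
  by (simp add: bij_pow_def)

lemma bij_pow_add:
  assumes "bij_betw f S S" "x \<in> S"
  shows "bij_pow S f (m + n) x = bij_pow S f m (bij_pow S f n x)"
proof (induction m rule: int_induct[where k = 0])
  case (step1 i)
  then show ?case
    using bij_pow_succ[OF assms, of "i + n"] bij_pow_succ[OF assms(1) bij_pow_closed[OF assms], of i]
    by (simp add: algebra_simps)
next
  case (step2 i)
  then show ?case
    using bij_pow_pred[OF assms, of "i + n"] bij_pow_pred[OF assms(1) bij_pow_closed[OF assms], of i]
    by (simp add: algebra_simps)
qed simp

text \<open>The inverse of a bijection preserving an operation preserves it too, so induction can
  run in both directions. The operation is binary in order to cover addition; a unary one such as
  negation is obtained by letting \<open>g\<close> ignore its second argument.\<close>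

lemma bij_pow_hom:
  assumes bij: "bij_betw f S S"
    and g: "\<And>x y. x \<in> S \<Longrightarrow> y \<in> S \<Longrightarrow> g x y \<in> S"
    and fg: "\<And>x y. x \<in> S \<Longrightarrow> y \<in> S \<Longrightarrow> f (g x y) = g (f x) (f y)"
    and x: "x \<in> S" and y: "y \<in> S"
  shows "bij_pow S f n (g x y) = g (bij_pow S f n x) (bij_pow S f n y)"
proof -
  have inv: "inv_into S f (g u v) = g (inv_into S f u) (inv_into S f v)" if "u \<in> S" "v \<in> S" for u v
  proof -
    have "inv_into S f u \<in> S" "inv_into S f v \<in> S"
      "f (inv_into S f u) = u" "f (inv_into S f v) = v"
      using bij that by (auto simp: bij_betw_def inv_into_into f_inv_into_f)
    then show ?thesis
      using fg g bij by (intro inv_into_f_eq) (auto simp: bij_betw_def)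
  qed
  show ?thesis
  proof (induction n rule: int_induct[where k = 0])
    case (step1 i)
    then show ?case
      by (simp add: bij_pow_succ bij_pow_closed bij x y g fg)
  next
    case (step2 i)
    then show ?case
      by (simp add: bij_pow_pred bij_pow_closed bij x y g inv)
  qed simp
qed

text \<open>To the right of 0 the recursion is applied; to the left a preimage is chosen at each
  step, which exists because \<open>h n\<close> maps \<open>K n\<close> onto
  \<open>K (n + 1)\<close>. The sets vary with the index because the coefficients of the form live
  in different residue fields.\<close>

lemma int_sequence_exists:
  fixes h :: "int \<Rightarrow> 'a \<Rightarrow> 'a"
  assumes e: "e \<in> K 0" and h: "\<And>n. h n ` K n = K (n + 1)"
  obtains d where "\<And>n. d n \<in> K n" and "\<And>n. d (n + 1) = h n (d n)"
proof -
  define f where "f = rec_nat e (\<lambda>n. h (int n))"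
  have f: "f 0 = e" "f (Suc n) = h (int n) (f n)" for n by (simp_all add: f_def)
  have fK: "f n \<in> K (int n)" for n
  proof (induction n)
    case (Suc n)
    then have "h (int n) (f n) \<in> K (int n + 1)" using h[of "int n"] by blast
    then show ?case by (simp add: f add.commute)
  qed (simp add: f e)
  \<comment> \<open>The entry \<open>g n\<close> sits at index -n, so \<open>g (Suc n)\<close> is a
    preimage of \<open>g n\<close> under the map \<open>h\<close> that leaves index -(n +
    1).\<close>
  define g where "g = rec_nat e (\<lambda>n x. inv_into (K (- int (Suc n))) (h (- int (Suc n))) x)"
  have g: "g 0 = e" "g (Suc n) = inv_into (K (- int (Suc n))) (h (- int (Suc n))) (g n)" for n
    by (simp_all add: g_def)
  have hK: "h (- int (Suc n)) ` K (- int (Suc n)) = K (- int n)" for n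
    using h[of "- int (Suc n)"] by simp
  have gK: "g n \<in> K (- int n)" for n
  proof (induction n)
    case (Suc n)
    then show ?case unfolding g by (intro inv_into_into) (use hK[of n] in simp)
  qed (simp add: g e)
  have gh: "h (- int (Suc n)) (g (Suc n)) = g n" for n
    unfolding g by (intro f_inv_into_f) (use hK[of n] gK[of n] in simp)
  define d where "d n = (if 0 \<le> n then f (nat n) else g (nat (- n)))" for n
  show thesis
  proof
    show "d n \<in> K n" for n
      using fK[of "nat n"] gK[of "nat (- n)"] by (auto simp: d_def split: if_splits)
    show "d (n + 1) = h n (d n)" for n
    proof (cases "0 \<le> n")
      case True
      then show ?thesis using f(2)[of "nat n"] by (simp add: d_def nat_add_distrib)
    next
      case False
      define k where "k = nat (- n - 1)"
      with False have n: "n = - int (Suc k)" by simp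
      \<comment> \<open>For k = 0 the step goes from index -1 to index 0, where the two halves meet
        in the common value \<open>e\<close>.\<close>
      show ?thesis using gh[of k] f(1) g(1) unfolding n d_def by (cases k) (simp_all add: nat_add_distrib)
    qed
  qed
qed

section \<open>Ring automorphisms acting on ideals and quotients\<close>

lemma (in ring) ring_iso_image_coset:
  assumes f: "f \<in> ring_iso R R" and I: "I \<subseteq> carrier R" and r: "r \<in> carrier R"
  shows "f ` (I +> r) = (f ` I) +> f r"
proof -
  have "f (x \<oplus> r) = f x \<oplus> f r" if "x \<in> I" for x
    using f I r that by (auto simp: ring_iso_def ring_hom_def)
  then show ?thesis by (force simp: a_r_coset_def')
qed

text \<open>The image under f is the preimage under the inverse automorphism, and preimages of
  ideals under ring homomorphisms are ideals.\<close>

lemma (in ring) ring_iso_image_ideal: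
  assumes f: "f \<in> ring_iso R R" and I: "ideal I R"
  shows "ideal (f ` I) R"
proof -
  let ?i = "inv_into (carrier R) f"
  have "?i \<in> ring_iso R R" by (rule ring_iso_set_sym[OF ring_axioms f])
  then interpret i: ring_hom_ring R R ?i
    by (intro ring_hom_ringI2 ring_axioms) (simp add: ring_iso_def)
  have bij: "bij_betw f (carrier R) (carrier R)" using f by (simp add: ring_iso_def)
  have sub: "I \<subseteq> carrier R" using I by (simp add: additive_subgroup.a_subset ideal.axioms(1))
  have "f ` I = {r \<in> carrier R. ?i r \<in> I}"
  proof (intro equalityI subsetI)
    fix r assume "r \<in> f ` I"
    then show "r \<in> {r \<in> carrier R. ?i r \<in> I}" using bij sub by (auto simp: bij_betw_def)
  next
    fix r assume r: "r \<in> {r \<in> carrier R. ?i r \<in> I}"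
    then have "f (?i r) = r" using bij by (simp add: bij_betw_def f_inv_into_f)
    with r show "r \<in> f ` I" by (metis (mono_tags, lifting) imageI mem_Collect_eq)
  qed
  then show ?thesis using i.ideal_vimage[OF I] by simp
qed

text \<open>An ideal above the image is pulled back by the inverse automorphism, compared with I by
  maximality, and pushed forward again.\<close>

lemma (in ring) ring_iso_image_maximalideal:
  assumes f: "f \<in> ring_iso R R" and I: "maximalideal I R"
  shows "maximalideal (f ` I) R"
proof (rule maximalidealI)
  let ?i = "inv_into (carrier R) f"
  have i: "?i \<in> ring_iso R R" by (rule ring_iso_set_sym[OF ring_axioms f])
  have bij: "bij_betw f (carrier R) (carrier R)" using f by (simp add: ring_iso_def)
  interpret I: maximalideal I R by fact
  have sub: "I \<subseteq> carrier R" by (rule I.a_subset)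
  have fi: "f ` ?i ` J = J" if "J \<subseteq> carrier R" for J
    using bij that by (force simp: bij_betw_def f_inv_into_f image_iff subset_eq)
  have iff: "?i ` f ` J = J" if "J \<subseteq> carrier R" for J
    using bij that by (force simp: bij_betw_def image_iff subset_eq)
  have ff: "f ` carrier R = carrier R" using bij by (simp add: bij_betw_def)
  show "ideal (f ` I) R" by (rule ring_iso_image_ideal[OF f I.is_ideal])
  show "carrier R \<noteq> f ` I"
  proof
    assume "carrier R = f ` I"
    then have "f ` carrier R = f ` I" using ff by simp
    then have "carrier R = I" by (metis iff order_refl sub)
    then show False using I.I_notcarr by simp
  qed
  fix J assume J: "ideal J R" "f ` I \<subseteq> J" "J \<subseteq> carrier R"
  have "I \<subseteq> ?i ` J" using J(2) iff[OF sub] by (metis image_mono)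
  moreover have "ideal (?i ` J) R" by (rule ring_iso_image_ideal[OF i J(1)])
  ultimately have "?i ` J = I \<or> ?i ` J = carrier R"
    using I.I_maximal ideal.Icarr by (metis subsetI)
  then show "J = f ` I \<or> J = carrier R" by (metis fi ff J(3))
qed

text \<open>Elements of a quotient are cosets, hence sets, so the induced isomorphism is simply the
  direct image. It is compatible with the operations because these can be computed on
  representatives, and injective because cosets are subsets of the carrier, on which f is injective.
  It is applied to \<sigma>, to its inverse and to star.\<close>

lemma (in ring) ring_iso_image_Quot:
  assumes f: "f \<in> ring_iso R R" and I: "ideal I R"
  shows "(`) f \<in> ring_iso (R Quot I) (R Quot (f ` I))"
proof (rule ring_iso_memI)
  interpret I: ideal I R by fact
  interpret J: ideal "f ` I" R by (rule ring_iso_image_ideal[OF f I])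
  have bij: "bij_betw f (carrier R) (carrier R)" using f by (simp add: ring_iso_def)
  have car: "carrier (R Quot J) = (\<lambda>r. J +> r) ` carrier R" for J
    by (auto simp: FactRing_def A_RCOSETS_def')
  note coset = ring_iso_image_coset[OF f I.a_subset]
  have cl: "f r \<in> carrier R" if "r \<in> carrier R" for r using that bij by (auto simp: bij_betw_def)
  have hom: "f (r \<oplus> s) = f r \<oplus> f s" "f (r \<otimes> s) = f r \<otimes> f s" "f \<one> = \<one>"
    if "r \<in> carrier R" "s \<in> carrier R" for r s
    using that f by (auto simp: ring_iso_def ring_hom_def)
  note hI = ring_hom_mult[OF I.rcos_ring_hom, symmetric] ring_hom_add[OF I.rcos_ring_hom, symmetric]
    ring_hom_one[OF I.rcos_ring_hom, symmetric]
  note hJ = ring_hom_mult[OF J.rcos_ring_hom, symmetric] ring_hom_add[OF J.rcos_ring_hom, symmetric]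
    ring_hom_one[OF J.rcos_ring_hom, symmetric]
  fix x y assume "x \<in> carrier (R Quot I)"
  then obtain r where r: "r \<in> carrier R" "x = I +> r" by (auto simp: car)
  show "f ` x \<in> carrier (R Quot (f ` I))" using r by (auto simp: car coset cl)
  assume "y \<in> carrier (R Quot I)"
  then obtain s where s: "s \<in> carrier R" "y = I +> s" by (auto simp: car)
  show "f ` (x \<otimes>\<^bsub>R Quot I\<^esub> y) = f ` x \<otimes>\<^bsub>R Quot (f ` I)\<^esub> f ` y"
    and "f ` (x \<oplus>\<^bsub>R Quot I\<^esub> y) = f ` x \<oplus>\<^bsub>R Quot (f ` I)\<^esub> f ` y"
    using r s by (simp_all add: hI hJ coset cl hom)
next
  interpret I: ideal I R by fact
  interpret J: ideal "f ` I" R by (rule ring_iso_image_ideal[OF f I])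
  show "f ` \<one>\<^bsub>R Quot I\<^esub> = \<one>\<^bsub>R Quot (f ` I)\<^esub>"
    using f by (simp add: FactRing_def ring_iso_image_coset[OF f I.a_subset] ring_iso_def ring_hom_def)
  have bij: "bij_betw f (carrier R) (carrier R)" using f by (simp add: ring_iso_def)
  have car: "carrier (R Quot J) = (\<lambda>r. J +> r) ` carrier R" for J
    by (auto simp: FactRing_def A_RCOSETS_def')
  have "(\<lambda>r. f ` (I +> r)) ` carrier R = (\<lambda>r. f ` I +> f r) ` carrier R"
    by (rule image_cong) (simp_all add: ring_iso_image_coset[OF f I.a_subset])
  also have "\<dots> = (\<lambda>r. f ` I +> r) ` f ` carrier R" by (simp only: image_image)
  also have "f ` carrier R = carrier R" using bij by (simp add: bij_betw_def)
  finally have "(`) f ` carrier (R Quot I) = carrier (R Quot (f ` I))"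
    by (simp only: car image_image)
  moreover have "inj_on ((`) f) (carrier (R Quot I))"
  proof (rule inj_onI)
    fix x y assume "x \<in> carrier (R Quot I)" "y \<in> carrier (R Quot I)" "f ` x = f ` y"
    moreover from this have "x \<subseteq> carrier R" "y \<subseteq> carrier R"
      using a_r_coset_subset_G[OF I.a_subset] by (auto simp: car)
    ultimately show "x = y" using bij by (metis bij_betw_def inj_on_image_eq_iff)
  qed
  ultimately show "bij_betw ((`) f) (carrier (R Quot I)) (carrier (R Quot (f ` I)))"
    by (simp add: bij_betw_def)
qed

section \<open>Separating maximal ideals\<close>

lemma maximalideal_not_subset:
  assumes "maximalideal \<mm> R" "maximalideal \<nn> R" "\<mm> \<noteq> \<nn>"
  shows "\<not> \<mm> \<subseteq> \<nn>"
proof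
  interpret n: maximalideal \<nn> R by fact
  assume "\<mm> \<subseteq> \<nn>"
  from maximalideal.I_maximal[OF assms(1) n.is_ideal this n.a_subset] assms(3) n.I_notcarr
  show False by auto
qed

text \<open>One element is chosen from each ideal of A outside \<nn>; their product lies in every
  ideal of A and, as \<nn> is prime, still outside \<nn>. Such an r annihilates finitely many
  components of a vector while remaining invertible modulo \<nn>.\<close>

lemma (in cring) maximalideals_avoid:
  assumes "finite A" "maximalideal \<nn> R" "\<nn> \<notin> A" "\<And>\<mm>. \<mm> \<in> A \<Longrightarrow> maximalideal \<mm> R"
  shows "\<exists>r\<in>carrier R. r \<notin> \<nn> \<and> (\<forall>\<mm>\<in>A. r \<in> \<mm>)"
  using assms(1,3,4)
proof induction
  case empty
  have "\<one> \<notin> \<nn>"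
    using maximalideal.I_notcarr[OF assms(2)] ideal.one_imp_carrier[OF maximalideal.axioms(1)[OF assms(2)]]
    by metis
  then show ?case by auto
next
  case (insert \<mm> A)
  then obtain r where r: "r \<in> carrier R" "r \<notin> \<nn>" "\<forall>\<mm>\<in>A. r \<in> \<mm>" by auto
  interpret m: maximalideal \<mm> R using insert.prems by simp
  interpret n: primeideal \<nn> R by (rule maximalideal_prime[OF assms(2)])
  have "\<not> \<mm> \<subseteq> \<nn>"
    using maximalideal_not_subset[OF m.is_maximalideal assms(2)] insert.prems(1) by auto
  then obtain s where s: "s \<in> \<mm>" "s \<notin> \<nn>" by auto
  have sc: "s \<in> carrier R" by (rule m.a_Hcarr[OF s(1)])
  have "s \<otimes> r \<in> \<mm>'" if "\<mm>' \<in> insert \<mm> A" for \<mm>'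
  proof -
    interpret i: maximalideal \<mm>' R using that insert.prems by blast
    show ?thesis using that r s sc i.I_l_closed i.I_r_closed by auto
  qed
  moreover have "s \<otimes> r \<notin> \<nn>" using n.I_prime[OF sc r(1)] r(2) s(2) by blast
  ultimately show ?case using sc r(1) by blast
qed

lemma gwa_homogeneous_terms: "gwa_homogeneous R d a \<Longrightarrow> a \<in> gwa_terms R"
  by (induction rule: gwa_homogeneous.induct) (auto intro: gwa_terms.intros)

text \<open>The scalar action of the algebra on both sides is determined by \<open>R\<close>, \<open>X\<close> and \<open>Y\<close>, so an
  operator-preserving bijection carries the module axioms along with the action.\<close>

lemma left_module_isomorphic_gwa_module:
  fixes R :: "('r, 'x) ring_scheme" and M :: "('r, 'v, 'y) module_scheme"
    and N :: "('r, 'w, 'z) module_scheme"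
  assumes d: "gwa_datum R star \<sigma> t" and M: "module R M"
    and X: "fX \<in> carrier M \<rightarrow> carrier M" and Y: "fY \<in> carrier M \<rightarrow> carrier M"
    and Xadd: "\<And>v w. v \<in> carrier M \<Longrightarrow> w \<in> carrier M \<Longrightarrow> fX (v \<oplus>\<^bsub>M\<^esub> w) = fX v \<oplus>\<^bsub>M\<^esub> fX w"
    and Yadd: "\<And>v w. v \<in> carrier M \<Longrightarrow> w \<in> carrier M \<Longrightarrow> fY (v \<oplus>\<^bsub>M\<^esub> w) = fY v \<oplus>\<^bsub>M\<^esub> fY w"
    and YX: "\<And>v. v \<in> carrier M \<Longrightarrow> fY (fX v) = t \<odot>\<^bsub>M\<^esub> v"
    and XY: "\<And>v. v \<in> carrier M \<Longrightarrow> fX (fY v) = \<sigma> t \<odot>\<^bsub>M\<^esub> v"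
    and Xr: "\<And>r v. r \<in> carrier R \<Longrightarrow> v \<in> carrier M \<Longrightarrow> fX (r \<odot>\<^bsub>M\<^esub> v) = \<sigma> r \<odot>\<^bsub>M\<^esub> fX v"
    and Yr: "\<And>r v. r \<in> carrier R \<Longrightarrow> v \<in> carrier M \<Longrightarrow>
      fY (r \<odot>\<^bsub>M\<^esub> v) = inv_into (carrier R) \<sigma> r \<odot>\<^bsub>M\<^esub> fY v"
    and bij: "bij_betw \<Phi> (carrier M) (carrier N)"
    and zero0: "\<Phi> \<zero>\<^bsub>M\<^esub> = \<zero>\<^bsub>N\<^esub>"
    and add: "\<And>v w. v \<in> carrier M \<Longrightarrow> w \<in> carrier M \<Longrightarrow> \<Phi> (v \<oplus>\<^bsub>M\<^esub> w) = \<Phi> v \<oplus>\<^bsub>N\<^esub> \<Phi> w"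
    and smult: "\<And>r v. r \<in> carrier R \<Longrightarrow> v \<in> carrier M \<Longrightarrow> \<Phi> (r \<odot>\<^bsub>M\<^esub> v) = r \<odot>\<^bsub>N\<^esub> \<Phi> v"
    and PX: "\<And>v. v \<in> carrier M \<Longrightarrow> \<Phi> (fX v) = gX (\<Phi> v)"
    and PY: "\<And>v. v \<in> carrier M \<Longrightarrow> \<Phi> (fY v) = gY (\<Phi> v)"
  shows "left_module_isomorphic (gwa R \<sigma> t) (gwa_module N gX gY) (gwa_module M fX fY)"
proof -
  interpret gwa_datum R star \<sigma> t by fact
  interpret M: module R M by fact
  have onto: "carrier N = \<Phi> ` carrier M" using bij by (simp add: bij_betw_def)
  have t: "t \<in> carrier R" "\<sigma> t \<in> carrier R"
    and s: "\<And>r. r \<in> carrier R \<Longrightarrow> \<sigma> r \<in> carrier R"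
      "\<And>r. r \<in> carrier R \<Longrightarrow> inv_into (carrier R) \<sigma> r \<in> carrier R"
    using t_closed sigma_iso by (auto simp: ring_iso_def bij_betw_def inv_into_into)
  have X': "fX v \<in> carrier M" and Y': "fY v \<in> carrier M" if "v \<in> carrier M" for v
    using that X Y by auto
  have addN: "\<And>v w. v \<in> carrier M \<Longrightarrow> w \<in> carrier M \<Longrightarrow> \<Phi> v \<oplus>\<^bsub>N\<^esub> \<Phi> w = \<Phi> (v \<oplus>\<^bsub>M\<^esub> w)"
    and smultN: "\<And>r v. r \<in> carrier R \<Longrightarrow> v \<in> carrier M \<Longrightarrow> r \<odot>\<^bsub>N\<^esub> \<Phi> v = \<Phi> (r \<odot>\<^bsub>M\<^esub> v)"
    and gX: "\<And>v. v \<in> carrier M \<Longrightarrow> gX (\<Phi> v) = \<Phi> (fX v)"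
    and gY: "\<And>v. v \<in> carrier M \<Longrightarrow> gY (\<Phi> v) = \<Phi> (fY v)"
    using add smult PX PY by auto
  \<comment> \<open>These rewrite rules are oriented towards M: every element of N is some
    \<open>\<Phi> v\<close>, and every operation of N is moved inside \<open>\<Phi>\<close>. The
    group and module laws of N, and the relations for \<open>gX\<close> and \<open>gY\<close>,
    thereby become those of M.\<close>
  note N = onto addN smultN gX gY zero0[symmetric] X' Y' t s
  have agN: "abelian_group N"
  proof (rule abelian_groupI)
    fix x assume "x \<in> carrier N"
    then obtain v where v: "v \<in> carrier M" "x = \<Phi> v" by (auto simp: onto)
    then show "\<exists>y\<in>carrier N. y \<oplus>\<^bsub>N\<^esub> x = \<zero>\<^bsub>N\<^esub>"
      by (intro bexI[of _ "\<Phi> (\<ominus>\<^bsub>M\<^esub> v)"]) (auto simp: N M.l_neg)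
  qed (auto simp: N M.add.m_ac)
  have modN: "module R N"
    by (rule moduleI[OF is_cring agN])
      (auto simp: N M.smult_l_distr M.smult_r_distr M.smult_assoc1)
  interpret N: module R N by fact
  note evM = d M X Y Xadd Yadd YX XY Xr Yr
  have evN: "gX \<in> carrier N \<rightarrow> carrier N" "gY \<in> carrier N \<rightarrow> carrier N"
    "\<And>v w. v \<in> carrier N \<Longrightarrow> w \<in> carrier N \<Longrightarrow> gX (v \<oplus>\<^bsub>N\<^esub> w) = gX v \<oplus>\<^bsub>N\<^esub> gX w"
    "\<And>v w. v \<in> carrier N \<Longrightarrow> w \<in> carrier N \<Longrightarrow> gY (v \<oplus>\<^bsub>N\<^esub> w) = gY v \<oplus>\<^bsub>N\<^esub> gY w"
    "\<And>v. v \<in> carrier N \<Longrightarrow> gY (gX v) = t \<odot>\<^bsub>N\<^esub> v"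
    "\<And>v. v \<in> carrier N \<Longrightarrow> gX (gY v) = \<sigma> t \<odot>\<^bsub>N\<^esub> v"
    "\<And>r v. r \<in> carrier R \<Longrightarrow> v \<in> carrier N \<Longrightarrow> gX (r \<odot>\<^bsub>N\<^esub> v) = \<sigma> r \<odot>\<^bsub>N\<^esub> gX v"
    "\<And>r v. r \<in> carrier R \<Longrightarrow> v \<in> carrier N \<Longrightarrow>
      gY (r \<odot>\<^bsub>N\<^esub> v) = inv_into (carrier R) \<sigma> r \<odot>\<^bsub>N\<^esub> gY v"
    by (auto simp: N Xadd Yadd YX XY Xr Yr)
  note evN = d modN this
  have ev: "gwa_eval N gX gY a (\<Phi> v) = \<Phi> (gwa_eval M fX fY a v)"
    if "a \<in> gwa_terms R" "v \<in> carrier M" for a v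
    using that
  proof (induction arbitrary: v)
    case (neg a)
    have cl: "gwa_eval M fX fY a v \<in> carrier M" using gwa_eval_closed[OF evM] neg by blast
    have "\<Phi> (\<ominus>\<^bsub>M\<^esub> gwa_eval M fX fY a v) \<oplus>\<^bsub>N\<^esub> \<Phi> (gwa_eval M fX fY a v) = \<zero>\<^bsub>N\<^esub>"
      using cl by (simp add: N M.l_neg)
    then have "\<ominus>\<^bsub>N\<^esub> \<Phi> (gwa_eval M fX fY a v) = \<Phi> (\<ominus>\<^bsub>M\<^esub> gwa_eval M fX fY a v)"
      by (rule N.minus_equality) (use cl in \<open>auto simp: N\<close>)
    then show ?case using neg by simp
  next
    case (add a b)
    then show ?case using gwa_eval_closed[OF evM] by (simp add: N)
  next
    case (mul a b)
    then show ?case using gwa_eval_closed[OF evM] by (simp add: N)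
  qed (simp_all add: N)
  \<comment> \<open>The isomorphism is wanted from N to M, while \<open>\<Phi>\<close> goes the
    other way.\<close>
  let ?\<Psi> = "inv_into (carrier M) \<Phi>"
  have \<Psi>: "?\<Psi> (\<Phi> v) = v" if "v \<in> carrier M" for v
    using bij that by (simp add: bij_betw_def)
  have c: "carrier (gwa_module M fX fY) = carrier M" "carrier (gwa_module N gX gY) = carrier N"
    "ring.add (gwa_module M fX fY) = ring.add M" "ring.add (gwa_module N gX gY) = ring.add N"
    "carrier (gwa R \<sigma> t) = gwa_class R \<sigma> t ` gwa_terms R"
    by (simp_all add: gwa_module_def gwa_def)
  show ?thesis unfolding left_module_isomorphic_def
  proof (intro conjI exI[of _ ?\<Psi>])
    show "left_module (gwa R \<sigma> t) (gwa_module N gX gY)" by (rule gwa_module_left_module[OF evN])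
    show "left_module (gwa R \<sigma> t) (gwa_module M fX fY)" by (rule gwa_module_left_module[OF evM])
    show "bij_betw ?\<Psi> (carrier (gwa_module N gX gY)) (carrier (gwa_module M fX fY))"
      unfolding c by (rule bij_betw_inv_into[OF bij])
    show "\<forall>v\<in>carrier (gwa_module N gX gY). \<forall>w\<in>carrier (gwa_module N gX gY).
        ?\<Psi> (v \<oplus>\<^bsub>gwa_module N gX gY\<^esub> w) = ?\<Psi> v \<oplus>\<^bsub>gwa_module M fX fY\<^esub> ?\<Psi> w"
      unfolding c by (auto simp: N \<Psi>)
    show "\<forall>a\<in>carrier (gwa R \<sigma> t). \<forall>v\<in>carrier (gwa_module N gX gY).
        ?\<Psi> (a \<odot>\<^bsub>gwa_module N gX gY\<^esub> v) = a \<odot>\<^bsub>gwa_module M fX fY\<^esub> ?\<Psi> v"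
      unfolding c
    proof clarify
      fix a x assume a: "a \<in> gwa_terms R" and x: "x \<in> carrier N"
      then obtain v where v: "v \<in> carrier M" "x = \<Phi> v" by (auto simp: onto)
      have "gwa_class R \<sigma> t a \<odot>\<^bsub>gwa_module N gX gY\<^esub> x = \<Phi> (gwa_eval M fX fY a v)"
        using gwa_module_smult[OF evN a x] ev[OF a v(1)] v(2) by simp
      then show "?\<Psi> (gwa_class R \<sigma> t a \<odot>\<^bsub>gwa_module N gX gY\<^esub> x) =
          gwa_class R \<sigma> t a \<odot>\<^bsub>gwa_module M fX fY\<^esub> ?\<Psi> x"
        using gwa_module_smult[OF evM a v(1)] v \<Psi> gwa_eval_closed[OF evM a v(1)] by simp
    qed
  qed
qed

section \<open>Componentwise description of the orbit sum\<close>

locale gwa_orbit = gwa_datum R star \<sigma> t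
  for R :: "('r, 'x) ring_scheme" (structure) and star \<sigma> t +
  fixes \<omega> :: "'r set set"
  assumes orbit: "\<omega> \<in> max_orbits R \<sigma>"
begin

abbreviation "\<sigma>i \<equiv> inv_into (carrier R) \<sigma>"
abbreviation "R\<omega> \<equiv> orbit_sum R \<omega>"
abbreviation "V \<equiv> orbit_module R \<sigma> t \<omega>"

lemma datum: "gwa_datum R star \<sigma> t"
  by (rule gwa_datum_axioms)

lemma sigma_bij: "bij_betw \<sigma> (carrier R) (carrier R)"
  using sigma_iso by (simp add: ring_iso_def)

lemma sigma_inv_iso: "\<sigma>i \<in> ring_iso R R"
  by (rule ring_iso_set_sym[OF ring_axioms sigma_iso])

lemma sigma_closed [simp]: "r \<in> carrier R \<Longrightarrow> \<sigma> r \<in> carrier R"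
  and sigma_inv_closed [simp]: "r \<in> carrier R \<Longrightarrow> \<sigma>i r \<in> carrier R"
  and sigma_sigma_inv [simp]: "r \<in> carrier R \<Longrightarrow> \<sigma> (\<sigma>i r) = r"
  and sigma_inv_sigma [simp]: "r \<in> carrier R \<Longrightarrow> \<sigma>i (\<sigma> r) = r"
  using sigma_bij by (auto simp: bij_betw_def inv_into_into f_inv_into_f)

lemma image_sigma_sigma_inv [simp]: "A \<subseteq> carrier R \<Longrightarrow> \<sigma> ` \<sigma>i ` A = A"
  and image_sigma_inv_sigma [simp]: "A \<subseteq> carrier R \<Longrightarrow> \<sigma>i ` \<sigma> ` A = A"
  by (force simp: image_iff subset_eq)+

text \<open>The enumeration sends n to the image of a fixed maximal ideal under the n-th power of
  \<sigma>. It may repeat when the orbit is finite. The last clause says that a coincidence persists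
  under every shift of the index; for an infinite orbit this is what excludes coincidences.\<close>

lemma orbit_enum:
  obtains \<mm> where "\<And>n. maximalideal (\<mm> n) R" and "\<omega> = range \<mm>"
    and "\<And>n::int. \<sigma> ` \<mm> n = \<mm> (n + 1)"
    and "\<And>j k n. \<mm> j = \<mm> k \<Longrightarrow> \<mm> (n + j) = \<mm> (n + k)"
proof -
  obtain \<mm>0 where m0: "maximalideal \<mm>0 R"
    and \<omega>: "\<omega> = {bij_pow (carrier R) \<sigma> n ` \<mm>0 | n. True}"
    using orbit by (auto simp: max_orbits_def max_spec_def)
  have sub: "\<mm>0 \<subseteq> carrier R"
    using m0 by (simp add: additive_subgroup.a_subset ideal.axioms(1) maximalideal.axioms(1))
  define \<mm> where "\<mm> n = bij_pow (carrier R) \<sigma> n ` \<mm>0" for n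
  have succ: "\<sigma> ` \<mm> n = \<mm> (n + 1)" for n
    using sub by (force simp: \<mm>_def image_image bij_pow_succ[OF sigma_bij] intro!: image_cong)
  have pred: "\<sigma>i ` \<mm> n = \<mm> (n - 1)" for n
    using sub by (force simp: \<mm>_def image_image bij_pow_pred[OF sigma_bij] intro!: image_cong)
  have max: "maximalideal (\<mm> n) R" for n
  proof (induction n rule: int_induct[where k = 0])
    case base
    show ?case using m0 by (simp add: \<mm>_def)
  next
    case (step1 i)
    show ?case using ring_iso_image_maximalideal[OF sigma_iso step1(2)] by (simp add: succ)
  next
    case (step2 i)
    show ?case using ring_iso_image_maximalideal[OF sigma_inv_iso step2(2)] by (simp add: pred)
  qed
  have "\<mm> (n + j) = bij_pow (carrier R) \<sigma> n ` \<mm> j" for n j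
    using sub by (force simp: \<mm>_def image_image bij_pow_add[OF sigma_bij] intro!: image_cong)
  then show thesis
    using that[of \<mm>] max succ \<omega> by (auto simp: \<mm>_def)
qed

lemma orbit_maximal: "\<mm> \<in> \<omega> \<Longrightarrow> maximalideal \<mm> R"
  by (rule orbit_enum) (blast elim: rangeE)

lemma orbit_subset_max_spec: "\<omega> \<subseteq> max_spec R"
  by (auto simp: max_spec_def orbit_maximal)

lemma orbit_ideal: "\<mm> \<in> \<omega> \<Longrightarrow> ideal \<mm> R"
  using orbit_maximal maximalideal.axioms(1) by blast

lemma orbit_subset [simp]: "\<mm> \<in> \<omega> \<Longrightarrow> \<mm> \<subseteq> carrier R"
  by (simp add: additive_subgroup.a_subset ideal.axioms(1) orbit_ideal)

lemma sigma_orbit [simp]: "\<mm> \<in> \<omega> \<Longrightarrow> \<sigma> ` \<mm> \<in> \<omega>"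
  by (rule orbit_enum) (metis rangeE rangeI)

lemma sigma_inv_orbit [simp]: "\<mm> \<in> \<omega> \<Longrightarrow> \<sigma>i ` \<mm> \<in> \<omega>"
proof (rule orbit_enum)
  fix k :: "int \<Rightarrow> 'r set"
  assume "\<mm> \<in> \<omega>" and k: "\<omega> = range k" "\<And>n. \<sigma> ` k n = k (n + 1)"
  then obtain n where "\<mm> = k n" by auto
  then have "\<mm> = \<sigma> ` k (n - 1)" using k(2)[of "n - 1"] by simp
  then have "\<sigma>i ` \<mm> = k (n - 1)" using k(1) by (simp add: orbit_subset)
  then show "\<sigma>i ` \<mm> \<in> \<omega>" using k(1) by simp
qed

lemma residue_field: "\<mm> \<in> \<omega> \<Longrightarrow> field (R Quot \<mm>)"
  using maximalideal.quotient_is_field[OF orbit_maximal is_cring] .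

lemma residue_cring: "\<mm> \<in> \<omega> \<Longrightarrow> cring (R Quot \<mm>)"
  and residue_ring: "\<mm> \<in> \<omega> \<Longrightarrow> ring (R Quot \<mm>)"
  and residue_abelian_group: "\<mm> \<in> \<omega> \<Longrightarrow> abelian_group (R Quot \<mm>)"
  and residue_monoid: "\<mm> \<in> \<omega> \<Longrightarrow> Group.monoid (R Quot \<mm>)"
  using residue_field
  by (meson cring.axioms(1) domain.axioms(1) field.axioms(1) ring.axioms(1) ring.is_monoid)+

lemma residue_hom: "\<mm> \<in> \<omega> \<Longrightarrow> (+>) \<mm> \<in> ring_hom R (R Quot \<mm>)"
  by (rule ideal.rcos_ring_hom[OF orbit_ideal])

lemma residue_closed [simp]: "\<mm> \<in> \<omega> \<Longrightarrow> r \<in> carrier R \<Longrightarrow> \<mm> +> r \<in> carrier (R Quot \<mm>)"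
  by (rule ring_hom_closed[OF residue_hom])

text \<open>As a coset, zero is the ideal itself. An automorphism therefore takes zero to zero by
  the mere fact that it moves the ideal.\<close>

lemma residue_zero: "\<zero>\<^bsub>R Quot \<mm>\<^esub> = \<mm>"
  by (simp add: FactRing_def)

lemma residue_eq_zero_iff:
  assumes "\<mm> \<in> \<omega>" "r \<in> carrier R"
  shows "\<mm> +> r = \<zero>\<^bsub>R Quot \<mm>\<^esub> \<longleftrightarrow> r \<in> \<mm>"
proof -
  have "subgroup \<mm> (add_monoid R)"
    using additive_subgroup.a_subgroup[OF ideal.axioms(1)[OF orbit_ideal[OF assms(1)]]] .
  from a_coset_join1[OF _ assms(2) this] a_coset_join2[OF assms(2) this]
  show ?thesis unfolding residue_zero by auto
qed

lemma residueE:
  assumes "\<mm> \<in> \<omega>" "x \<in> carrier (R Quot \<mm>)"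
  obtains r where "r \<in> carrier R" "x = \<mm> +> r"
  using assms(2) by (auto simp: FactRing_def A_RCOSETS_def')

lemma image_sigma_iso: "\<mm> \<in> \<omega> \<Longrightarrow> (`) \<sigma> \<in> ring_iso (R Quot \<mm>) (R Quot (\<sigma> ` \<mm>))"
  by (rule ring_iso_image_Quot[OF sigma_iso orbit_ideal])

lemma image_sigma_inv_iso: "\<mm> \<in> \<omega> \<Longrightarrow> (`) \<sigma>i \<in> ring_iso (R Quot \<mm>) (R Quot (\<sigma>i ` \<mm>))"
  by (rule ring_iso_image_Quot[OF sigma_inv_iso orbit_ideal])

lemma image_sigma_coset:
  "\<mm> \<in> \<omega> \<Longrightarrow> r \<in> carrier R \<Longrightarrow> \<sigma> ` (\<mm> +> r) = (\<sigma> ` \<mm>) +> \<sigma> r"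
  by (rule ring_iso_image_coset[OF sigma_iso orbit_subset])

lemma residue_subset: "\<mm> \<in> \<omega> \<Longrightarrow> x \<in> carrier (R Quot \<mm>) \<Longrightarrow> x \<subseteq> carrier R"
  by (metis a_r_coset_subset_G orbit_subset residueE)

lemma orbit_sum_carrier:
  "carrier R\<omega> = {v \<in> \<Pi>\<^sub>E \<mm>\<in>\<omega>. carrier (R Quot \<mm>). finite {\<mm> \<in> \<omega>. v \<mm> \<noteq> \<zero>\<^bsub>R Quot \<mm>\<^esub>}}"
proof -
  have "group (add_monoid (R Quot \<mm>))" if "\<mm> \<in> \<omega>" for \<mm>
    using abelian_group.a_group[OF residue_abelian_group[OF that]] .
  then show ?thesis by (simp add: orbit_sum_def carrier_sum_group)
qed

lemma orbit_sum_component [simp]: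
  "v \<in> carrier R\<omega> \<Longrightarrow> \<mm> \<in> \<omega> \<Longrightarrow> v \<mm> \<in> carrier (R Quot \<mm>)"
  by (auto simp: orbit_sum_carrier)

text \<open>Any finite set containing the support is accepted, so a bound can be named without
  computing the support exactly.\<close>

lemma orbit_sum_memI:
  assumes "\<And>\<mm>. \<mm> \<in> \<omega> \<Longrightarrow> f \<mm> \<in> carrier (R Quot \<mm>)"
    and "\<And>\<mm>. \<mm> \<in> \<omega> \<Longrightarrow> \<mm> \<notin> A \<Longrightarrow> f \<mm> = \<zero>\<^bsub>R Quot \<mm>\<^esub>" and "finite A"
  shows "(\<lambda>\<mm>\<in>\<omega>. f \<mm>) \<in> carrier R\<omega>"
proof -
  have "{\<mm> \<in> \<omega>. restrict f \<omega> \<mm> \<noteq> \<zero>\<^bsub>R Quot \<mm>\<^esub>} \<subseteq> A" using assms(2) by auto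
  then have "finite {\<mm> \<in> \<omega>. restrict f \<omega> \<mm> \<noteq> \<zero>\<^bsub>R Quot \<mm>\<^esub>}"
    using \<open>finite A\<close> by (rule finite_subset)
  then show ?thesis
    using assms(1) unfolding orbit_sum_carrier mem_Collect_eq restrict_PiE_iff by blast
qed

lemma orbit_sum_eqI:
  assumes "u \<in> carrier R\<omega>" "v \<in> carrier R\<omega>" "\<And>\<mm>. \<mm> \<in> \<omega> \<Longrightarrow> u \<mm> = v \<mm>"
  shows "u = v"
  using assms by (auto simp: orbit_sum_carrier intro: PiE_ext)

lemma orbit_sum_add_apply [simp]: "\<mm> \<in> \<omega> \<Longrightarrow> (u \<oplus>\<^bsub>R\<omega>\<^esub> v) \<mm> = u \<mm> \<oplus>\<^bsub>R Quot \<mm>\<^esub> v \<mm>"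
  and orbit_sum_smult_apply [simp]: "\<mm> \<in> \<omega> \<Longrightarrow> (r \<odot>\<^bsub>R\<omega>\<^esub> v) \<mm> = (\<mm> +> r) \<otimes>\<^bsub>R Quot \<mm>\<^esub> v \<mm>"
  and orbit_sum_zero_apply [simp]: "\<mm> \<in> \<omega> \<Longrightarrow> \<zero>\<^bsub>R\<omega>\<^esub> \<mm> = \<zero>\<^bsub>R Quot \<mm>\<^esub>"
  by (simp_all add: orbit_sum_def)

lemma orbit_sum_support: "v \<in> carrier R\<omega> \<Longrightarrow> finite {\<mm> \<in> \<omega>. v \<mm> \<noteq> \<zero>\<^bsub>R Quot \<mm>\<^esub>}"
  by (simp add: orbit_sum_carrier)

lemma orbit_sum_zero_closed: "\<zero>\<^bsub>R\<omega>\<^esub> \<in> carrier R\<omega>"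
  unfolding orbit_sum_def ring.simps
  using orbit_sum_memI[where A = "{}" and f = "\<lambda>\<mm>. \<zero>\<^bsub>R Quot \<mm>\<^esub>"]
  by (auto simp: orbit_sum_def ring.ring_simprules(2)[OF residue_ring])

lemma orbit_sum_add_closed:
  assumes "u \<in> carrier R\<omega>" "v \<in> carrier R\<omega>"
  shows "u \<oplus>\<^bsub>R\<omega>\<^esub> v \<in> carrier R\<omega>"
proof -
  have "(\<lambda>\<mm>\<in>\<omega>. u \<mm> \<oplus>\<^bsub>R Quot \<mm>\<^esub> v \<mm>) \<in> carrier R\<omega>"
    by (rule orbit_sum_memI[where A = "{\<mm> \<in> \<omega>. u \<mm> \<noteq> \<zero>\<^bsub>R Quot \<mm>\<^esub>} \<union> {\<mm> \<in> \<omega>. v \<mm> \<noteq> \<zero>\<^bsub>R Quot \<mm>\<^esub>}"])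
      (use assms in \<open>auto simp: orbit_sum_support ring.ring_simprules[OF residue_ring]\<close>)
  then show ?thesis by (simp add: orbit_sum_def)
qed

lemma orbit_sum_smult_closed:
  assumes "r \<in> carrier R" "v \<in> carrier R\<omega>"
  shows "r \<odot>\<^bsub>R\<omega>\<^esub> v \<in> carrier R\<omega>"
proof -
  have "(\<lambda>\<mm>\<in>\<omega>. (\<mm> +> r) \<otimes>\<^bsub>R Quot \<mm>\<^esub> v \<mm>) \<in> carrier R\<omega>"
    by (rule orbit_sum_memI[where A = "{\<mm> \<in> \<omega>. v \<mm> \<noteq> \<zero>\<^bsub>R Quot \<mm>\<^esub>}"])
      (use assms in \<open>auto simp: orbit_sum_support ring.ring_simprules[OF residue_ring]\<close>)
  then show ?thesis by (simp add: orbit_sum_def)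
qed

lemma orbit_sum_module: "module R R\<omega>"
proof (rule moduleI[OF is_cring])
  show "abelian_group R\<omega>"
  proof (rule abelian_groupI)
    fix u assume u: "u \<in> carrier R\<omega>"
    \<comment> \<open>The scalar multiple by -1 serves as the additive inverse, since its membership
      is already known from closure under scalars.\<close>
    have "\<ominus> \<one> \<odot>\<^bsub>R\<omega>\<^esub> u \<oplus>\<^bsub>R\<omega>\<^esub> u = \<zero>\<^bsub>R\<omega>\<^esub>"
    proof (rule orbit_sum_eqI)
      fix \<mm> assume m: "\<mm> \<in> \<omega>"
      interpret K: cring "R Quot \<mm>" by (rule residue_cring[OF m])
      interpret h: ring_hom_cring R "R Quot \<mm>" "(+>) \<mm>"
        by (rule ideal.rcos_ring_hom_cring[OF orbit_ideal[OF m] is_cring])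
      show "(\<ominus> \<one> \<odot>\<^bsub>R\<omega>\<^esub> u \<oplus>\<^bsub>R\<omega>\<^esub> u) \<mm> = \<zero>\<^bsub>R\<omega>\<^esub> \<mm>"
        using m u by (simp add: K.l_minus K.l_neg)
    qed (use u in \<open>auto intro!: orbit_sum_add_closed orbit_sum_smult_closed orbit_sum_zero_closed\<close>)
    then show "\<exists>y\<in>carrier R\<omega>. y \<oplus>\<^bsub>R\<omega>\<^esub> u = \<zero>\<^bsub>R\<omega>\<^esub>"
      using u orbit_sum_smult_closed by blast
  qed (auto intro!: orbit_sum_add_closed orbit_sum_zero_closed orbit_sum_eqI
      simp: ring.ring_simprules[OF residue_ring])
qed (auto intro!: orbit_sum_add_closed orbit_sum_smult_closed orbit_sum_eqI
    simp: ring.ring_simprules[OF residue_ring] ring_hom_add[OF residue_hom]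
      ring_hom_mult[OF residue_hom] ring_hom_one[OF residue_hom])

end

section \<open>The module of the orbit\<close>

context gwa_orbit
begin

section \<open>The semilinear action of \<sigma> on the orbit sum\<close>

lemma image_sigma_closed: "\<mm> \<in> \<omega> \<Longrightarrow> x \<in> carrier (R Quot \<mm>) \<Longrightarrow> \<sigma> ` x \<in> carrier (R Quot (\<sigma> ` \<mm>))"
  and image_sigma_add: "\<mm> \<in> \<omega> \<Longrightarrow> x \<in> carrier (R Quot \<mm>) \<Longrightarrow> y \<in> carrier (R Quot \<mm>) \<Longrightarrow>
    \<sigma> ` (x \<oplus>\<^bsub>R Quot \<mm>\<^esub> y) = \<sigma> ` x \<oplus>\<^bsub>R Quot (\<sigma> ` \<mm>)\<^esub> \<sigma> ` y"
  and image_sigma_mult: "\<mm> \<in> \<omega> \<Longrightarrow> x \<in> carrier (R Quot \<mm>) \<Longrightarrow> y \<in> carrier (R Quot \<mm>) \<Longrightarrow>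
    \<sigma> ` (x \<otimes>\<^bsub>R Quot \<mm>\<^esub> y) = \<sigma> ` x \<otimes>\<^bsub>R Quot (\<sigma> ` \<mm>)\<^esub> \<sigma> ` y"
  using ring_iso_memE[OF image_sigma_iso] by auto

lemma image_sigma_inv_closed:
  "\<mm> \<in> \<omega> \<Longrightarrow> x \<in> carrier (R Quot \<mm>) \<Longrightarrow> \<sigma>i ` x \<in> carrier (R Quot (\<sigma>i ` \<mm>))"
  using ring_iso_memE(1)[OF image_sigma_inv_iso] by auto

lemma orbit_sigma_apply: "\<mm> \<in> \<omega> \<Longrightarrow> orbit_sigma R \<sigma> \<omega> u \<mm> = \<sigma> ` u (\<sigma>i ` \<mm>)"
  by (simp add: orbit_sigma_def)

lemma orbit_sigma_closed:
  assumes "u \<in> carrier R\<omega>"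
  shows "orbit_sigma R \<sigma> \<omega> u \<in> carrier R\<omega>"
  unfolding orbit_sigma_def
proof (rule orbit_sum_memI)
  let ?A = "{\<mm> \<in> \<omega>. u \<mm> \<noteq> \<zero>\<^bsub>R Quot \<mm>\<^esub>}"
  \<comment> \<open>The support of the shifted vector is contained in the image of the old support
    under \<sigma>.\<close>
  show "finite ((`) \<sigma> ` ?A)" using orbit_sum_support[OF assms] by simp
  fix \<mm> assume m: "\<mm> \<in> \<omega>"
  show "\<sigma> ` u (\<sigma>i ` \<mm>) \<in> carrier (R Quot \<mm>)"
    using image_sigma_closed[of "\<sigma>i ` \<mm>"] m assms by simp
  assume A: "\<mm> \<notin> (`) \<sigma> ` ?A"
  have "\<sigma>i ` \<mm> \<notin> ?A"
  proof
    assume "\<sigma>i ` \<mm> \<in> ?A"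
    then have "\<sigma> ` \<sigma>i ` \<mm> \<in> (`) \<sigma> ` ?A" by (rule imageI)
    then show False using A unfolding image_sigma_sigma_inv[OF orbit_subset[OF m]] by contradiction
  qed
  then have "u (\<sigma>i ` \<mm>) = \<sigma>i ` \<mm>" using sigma_inv_orbit[OF m] unfolding residue_zero by blast
  then show "\<sigma> ` u (\<sigma>i ` \<mm>) = \<zero>\<^bsub>R Quot \<mm>\<^esub>"
    using image_sigma_sigma_inv[OF orbit_subset[OF m]] by (simp only: residue_zero)
qed

lemma orbit_sigma_add:
  assumes "u \<in> carrier R\<omega>" "v \<in> carrier R\<omega>"
  shows "orbit_sigma R \<sigma> \<omega> (u \<oplus>\<^bsub>R\<omega>\<^esub> v) = orbit_sigma R \<sigma> \<omega> u \<oplus>\<^bsub>R\<omega>\<^esub> orbit_sigma R \<sigma> \<omega> v"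
  using assms
  by (intro orbit_sum_eqI orbit_sum_add_closed orbit_sigma_closed)
    (auto simp: orbit_sigma_apply image_sigma_add)

lemma orbit_sigma_smult:
  assumes "r \<in> carrier R" "v \<in> carrier R\<omega>"
  shows "orbit_sigma R \<sigma> \<omega> (r \<odot>\<^bsub>R\<omega>\<^esub> v) = \<sigma> r \<odot>\<^bsub>R\<omega>\<^esub> orbit_sigma R \<sigma> \<omega> v"
  using assms
  by (intro orbit_sum_eqI orbit_sum_smult_closed orbit_sigma_closed)
    (auto simp: orbit_sigma_apply image_sigma_mult image_sigma_coset)

lemma orbit_sigma_bij: "bij_betw (orbit_sigma R \<sigma> \<omega>) (carrier R\<omega>) (carrier R\<omega>)"
proof (rule bij_betw_byWitness)
  define \<tau> where "\<tau> v = (\<lambda>\<mm>\<in>\<omega>. \<sigma>i ` v (\<sigma> ` \<mm>))" for v :: "'r set \<Rightarrow> 'r set"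
  have \<tau>_apply: "\<tau> v \<mm> = \<sigma>i ` v (\<sigma> ` \<mm>)" if "\<mm> \<in> \<omega>" for v \<mm>
    using that by (simp add: \<tau>_def)
  have cl: "\<tau> v \<in> carrier R\<omega>" if v: "v \<in> carrier R\<omega>" for v
    unfolding \<tau>_def
  proof (rule orbit_sum_memI)
    let ?A = "{\<mm> \<in> \<omega>. v \<mm> \<noteq> \<zero>\<^bsub>R Quot \<mm>\<^esub>}"
    show "finite ((`) \<sigma>i ` ?A)" using orbit_sum_support[OF v] by simp
    fix \<mm> assume m: "\<mm> \<in> \<omega>"
    show "\<sigma>i ` v (\<sigma> ` \<mm>) \<in> carrier (R Quot \<mm>)"
      using image_sigma_inv_closed[of "\<sigma> ` \<mm>"] m v by simp
    assume A: "\<mm> \<notin> (`) \<sigma>i ` ?A"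
    have "\<sigma> ` \<mm> \<notin> ?A"
    proof
      assume "\<sigma> ` \<mm> \<in> ?A"
      then have "\<sigma>i ` \<sigma> ` \<mm> \<in> (`) \<sigma>i ` ?A" by (rule imageI)
      then show False using A unfolding image_sigma_inv_sigma[OF orbit_subset[OF m]] by contradiction
    qed
    then have "v (\<sigma> ` \<mm>) = \<sigma> ` \<mm>" using sigma_orbit[OF m] unfolding residue_zero by blast
    then show "\<sigma>i ` v (\<sigma> ` \<mm>) = \<zero>\<^bsub>R Quot \<mm>\<^esub>"
      using image_sigma_inv_sigma[OF orbit_subset[OF m]] by (simp only: residue_zero)
  qed
  then show "\<tau> ` carrier R\<omega> \<subseteq> carrier R\<omega>" by auto
  show "orbit_sigma R \<sigma> \<omega> ` carrier R\<omega> \<subseteq> carrier R\<omega>" using orbit_sigma_closed by auto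
  show "\<forall>v\<in>carrier R\<omega>. \<tau> (orbit_sigma R \<sigma> \<omega> v) = v"
    by (auto intro!: orbit_sum_eqI cl orbit_sigma_closed
        simp: \<tau>_apply orbit_sigma_apply image_sigma_inv_sigma[OF residue_subset])
  show "\<forall>v\<in>carrier R\<omega>. orbit_sigma R \<sigma> \<omega> (\<tau> v) = v"
    by (auto intro!: orbit_sum_eqI cl orbit_sigma_closed
        simp: \<tau>_apply orbit_sigma_apply image_sigma_sigma_inv[OF residue_subset])
qed

lemma orbit_sigma_inv_closed: "v \<in> carrier R\<omega> \<Longrightarrow> orbit_sigma_inv R \<sigma> \<omega> v \<in> carrier R\<omega>"
  and orbit_sigma_inv_right: "v \<in> carrier R\<omega> \<Longrightarrow> orbit_sigma R \<sigma> \<omega> (orbit_sigma_inv R \<sigma> \<omega> v) = v"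
  and orbit_sigma_inv_left: "v \<in> carrier R\<omega> \<Longrightarrow> orbit_sigma_inv R \<sigma> \<omega> (orbit_sigma R \<sigma> \<omega> v) = v"
  using orbit_sigma_bij unfolding orbit_sigma_inv_def
  by (auto simp: bij_betw_def inv_into_into f_inv_into_f)

text \<open>The inverse is given abstractly by \<open>inv_into\<close>. Its component formula is
  recovered by reading the equation \<sigma>(u) = v at the index \<sigma>(\<mm>) and undoing the
  direct image.\<close>

lemma orbit_sigma_inv_apply:
  assumes "v \<in> carrier R\<omega>" "\<mm> \<in> \<omega>"
  shows "orbit_sigma_inv R \<sigma> \<omega> v \<mm> = \<sigma>i ` v (\<sigma> ` \<mm>)"
proof -
  let ?u = "orbit_sigma_inv R \<sigma> \<omega> v"
  have "?u \<mm> \<subseteq> carrier R"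
    using assms orbit_sigma_inv_closed by (intro residue_subset[of \<mm>]) auto
  moreover have "v (\<sigma> ` \<mm>) = \<sigma> ` ?u \<mm>"
    using orbit_sigma_apply[of "\<sigma> ` \<mm>" ?u] assms by (simp add: orbit_sigma_inv_right)
  ultimately show ?thesis by simp
qed

lemma orbit_sigma_inv_eqI:
  "u \<in> carrier R\<omega> \<Longrightarrow> orbit_sigma R \<sigma> \<omega> u = v \<Longrightarrow> orbit_sigma_inv R \<sigma> \<omega> v = u"
  using orbit_sigma_inv_left by auto

lemma orbit_sigma_inv_add:
  assumes "u \<in> carrier R\<omega>" "v \<in> carrier R\<omega>"
  shows "orbit_sigma_inv R \<sigma> \<omega> (u \<oplus>\<^bsub>R\<omega>\<^esub> v) =
    orbit_sigma_inv R \<sigma> \<omega> u \<oplus>\<^bsub>R\<omega>\<^esub> orbit_sigma_inv R \<sigma> \<omega> v"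
  using assms
  by (intro orbit_sigma_inv_eqI)
    (simp_all add: orbit_sum_add_closed orbit_sigma_inv_closed orbit_sigma_add orbit_sigma_inv_right)

lemma orbit_sigma_inv_smult:
  assumes "r \<in> carrier R" "v \<in> carrier R\<omega>"
  shows "orbit_sigma_inv R \<sigma> \<omega> (r \<odot>\<^bsub>R\<omega>\<^esub> v) = \<sigma>i r \<odot>\<^bsub>R\<omega>\<^esub> orbit_sigma_inv R \<sigma> \<omega> v"
  using assms
  by (intro orbit_sigma_inv_eqI)
    (simp_all add: orbit_sum_smult_closed orbit_sigma_inv_closed orbit_sigma_smult orbit_sigma_inv_right)

abbreviation "VX \<equiv> \<lambda>v. orbit_sigma R \<sigma> \<omega> (t \<odot>\<^bsub>R\<omega>\<^esub> v)"
abbreviation "VY \<equiv> orbit_sigma_inv R \<sigma> \<omega>"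

text \<open>All clauses come from semilinearity of \<sigma>: multiplying by t before the shift turns
  XY into \<sigma>(t), and commutativity of R moves r past t. They are listed in the order of the
  hypotheses of \<open>gwa_eval_closed\<close> and its companions, so that
  \<open>orbit_eval_hyps\<close> discharges those hypotheses at once.\<close>

lemma orbit_module_relations:
  shows "VX \<in> carrier R\<omega> \<rightarrow> carrier R\<omega>" and "VY \<in> carrier R\<omega> \<rightarrow> carrier R\<omega>"
    and "\<And>v w. v \<in> carrier R\<omega> \<Longrightarrow> w \<in> carrier R\<omega> \<Longrightarrow> VX (v \<oplus>\<^bsub>R\<omega>\<^esub> w) = VX v \<oplus>\<^bsub>R\<omega>\<^esub> VX w"
    and "\<And>v w. v \<in> carrier R\<omega> \<Longrightarrow> w \<in> carrier R\<omega> \<Longrightarrow> VY (v \<oplus>\<^bsub>R\<omega>\<^esub> w) = VY v \<oplus>\<^bsub>R\<omega>\<^esub> VY w"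
    and "\<And>v. v \<in> carrier R\<omega> \<Longrightarrow> VY (VX v) = t \<odot>\<^bsub>R\<omega>\<^esub> v"
    and "\<And>v. v \<in> carrier R\<omega> \<Longrightarrow> VX (VY v) = \<sigma> t \<odot>\<^bsub>R\<omega>\<^esub> v"
    and "\<And>r v. r \<in> carrier R \<Longrightarrow> v \<in> carrier R\<omega> \<Longrightarrow> VX (r \<odot>\<^bsub>R\<omega>\<^esub> v) = \<sigma> r \<odot>\<^bsub>R\<omega>\<^esub> VX v"
    and "\<And>r v. r \<in> carrier R \<Longrightarrow> v \<in> carrier R\<omega> \<Longrightarrow> VY (r \<odot>\<^bsub>R\<omega>\<^esub> v) = \<sigma>i r \<odot>\<^bsub>R\<omega>\<^esub> VY v"
proof -
  interpret M: module R R\<omega> by (rule orbit_sum_module)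
  have comm: "t \<odot>\<^bsub>R\<omega>\<^esub> (r \<odot>\<^bsub>R\<omega>\<^esub> v) = r \<odot>\<^bsub>R\<omega>\<^esub> (t \<odot>\<^bsub>R\<omega>\<^esub> v)"
    if "r \<in> carrier R" "v \<in> carrier R\<omega>" for r v
    using that t_closed by (simp add: M.smult_assoc1[symmetric] m_comm)
  show "VX \<in> carrier R\<omega> \<rightarrow> carrier R\<omega>" "VY \<in> carrier R\<omega> \<rightarrow> carrier R\<omega>"
    by (simp_all add: orbit_sigma_closed orbit_sigma_inv_closed t_closed)
  show "VX (v \<oplus>\<^bsub>R\<omega>\<^esub> w) = VX v \<oplus>\<^bsub>R\<omega>\<^esub> VX w" "VY (v \<oplus>\<^bsub>R\<omega>\<^esub> w) = VY v \<oplus>\<^bsub>R\<omega>\<^esub> VY w"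
    if "v \<in> carrier R\<omega>" "w \<in> carrier R\<omega>" for v w
    using that by (simp_all add: M.smult_r_distr orbit_sigma_add orbit_sigma_inv_add t_closed)
  show "VY (VX v) = t \<odot>\<^bsub>R\<omega>\<^esub> v" if "v \<in> carrier R\<omega>" for v
    using that by (simp add: orbit_sigma_inv_left t_closed)
  show "VX (VY v) = \<sigma> t \<odot>\<^bsub>R\<omega>\<^esub> v" if "v \<in> carrier R\<omega>" for v
    using that
    by (simp add: orbit_sigma_smult orbit_sigma_inv_right orbit_sigma_inv_closed t_closed)
  show "VX (r \<odot>\<^bsub>R\<omega>\<^esub> v) = \<sigma> r \<odot>\<^bsub>R\<omega>\<^esub> VX v" "VY (r \<odot>\<^bsub>R\<omega>\<^esub> v) = \<sigma>i r \<odot>\<^bsub>R\<omega>\<^esub> VY v"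
    if "r \<in> carrier R" "v \<in> carrier R\<omega>" for r v
    using that by (simp_all add: comm orbit_sigma_smult orbit_sigma_inv_smult t_closed)
qed

lemmas orbit_eval_hyps = datum orbit_sum_module orbit_module_relations

lemma orbit_module_left_module: "left_module (gwa R \<sigma> t) V"
  unfolding orbit_module_def by (rule gwa_module_left_module[OF orbit_eval_hyps])

lemma orbit_module_simps [simp]:
  "carrier V = carrier R\<omega>" "ring.add V = ring.add R\<omega>" "ring.zero V = ring.zero R\<omega>"
  by (simp_all add: orbit_module_def gwa_module_def)

lemma orbit_module_smult:
  "a \<in> gwa_terms R \<Longrightarrow> v \<in> carrier R\<omega> \<Longrightarrow>
    gwa_class R \<sigma> t a \<odot>\<^bsub>V\<^esub> v = gwa_eval R\<omega> VX VY a v"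
  unfolding orbit_module_def by (rule gwa_module_smult[OF orbit_eval_hyps])

lemma orbit_module_coef [simp]:
    "r \<in> carrier R \<Longrightarrow> v \<in> carrier R\<omega> \<Longrightarrow> gwa_coef R \<sigma> t r \<odot>\<^bsub>V\<^esub> v = r \<odot>\<^bsub>R\<omega>\<^esub> v"
  and orbit_module_X [simp]: "v \<in> carrier R\<omega> \<Longrightarrow> gwa_X R \<sigma> t \<odot>\<^bsub>V\<^esub> v = VX v"
  and orbit_module_Y [simp]: "v \<in> carrier R\<omega> \<Longrightarrow> gwa_Y R \<sigma> t \<odot>\<^bsub>V\<^esub> v = VY v"
  by (simp_all add: gwa_coef_def gwa_X_def gwa_Y_def orbit_module_smult gwa_terms.intros)

section \<open>Weight decomposition of the orbit module\<close>

definition single :: "'r set \<Rightarrow> 'r set \<Rightarrow> 'r set \<Rightarrow> 'r set" where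
  "single \<mm> x = (\<lambda>\<nn>\<in>\<omega>. if \<nn> = \<mm> then x else \<zero>\<^bsub>R Quot \<nn>\<^esub>)"

lemma single_apply: "\<nn> \<in> \<omega> \<Longrightarrow> single \<mm> x \<nn> = (if \<nn> = \<mm> then x else \<zero>\<^bsub>R Quot \<nn>\<^esub>)"
  by (simp add: single_def)

lemma single_closed: "\<mm> \<in> \<omega> \<Longrightarrow> x \<in> carrier (R Quot \<mm>) \<Longrightarrow> single \<mm> x \<in> carrier R\<omega>"
  unfolding single_def
  by (rule orbit_sum_memI[where A = "{\<mm>}"]) (auto simp: ring.ring_simprules[OF residue_ring])

text \<open>For \<nn> different from \<mm> some r in \<mm> lies outside \<nn>, hence is nonzero in
  the field R/\<nn>, and r v = 0 forces the component at \<nn> to vanish. Conversely r in \<mm> is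
  zero in R/\<mm>. Ideals outside the orbit are included: there the description leaves only the zero
  vector.\<close>

lemma weight_space_orbit_module:
  assumes "\<mm> \<in> max_spec R"
  shows "weight_space R \<sigma> t V \<mm> =
    {v \<in> carrier R\<omega>. \<forall>\<nn>\<in>\<omega>. \<nn> \<noteq> \<mm> \<longrightarrow> v \<nn> = \<zero>\<^bsub>R Quot \<nn>\<^esub>}"
proof -
  have m: "maximalideal \<mm> R" using assms by (simp add: max_spec_def)
  have sub: "\<mm> \<subseteq> carrier R"
    by (simp add: additive_subgroup.a_subset ideal.axioms(1) maximalideal.axioms(1) m)
  interpret M: module R R\<omega> by (rule orbit_sum_module)
  have iff: "(\<forall>r\<in>\<mm>. r \<odot>\<^bsub>R\<omega>\<^esub> v = \<zero>\<^bsub>R\<omega>\<^esub>) \<longleftrightarrow> (\<forall>\<nn>\<in>\<omega>. \<nn> \<noteq> \<mm> \<longrightarrow> v \<nn> = \<zero>\<^bsub>R Quot \<nn>\<^esub>)"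
    (is "?L \<longleftrightarrow> ?Q") if v: "v \<in> carrier R\<omega>" for v
  proof
    assume L: ?L
    show ?Q
    proof (intro ballI impI)
      fix \<nn> assume n: "\<nn> \<in> \<omega>" "\<nn> \<noteq> \<mm>"
      then obtain r where r: "r \<in> \<mm>" "r \<notin> \<nn>"
        using maximalideal_not_subset[OF m orbit_maximal] by blast
      interpret K: field "R Quot \<nn>" by (rule residue_field[OF n(1)])
      have "(\<nn> +> r) \<otimes>\<^bsub>R Quot \<nn>\<^esub> v \<nn> = \<zero>\<^bsub>R Quot \<nn>\<^esub>"
        using L r(1) n(1) by (metis orbit_sum_smult_apply orbit_sum_zero_apply)
      moreover have "\<nn> +> r \<noteq> \<zero>\<^bsub>R Quot \<nn>\<^esub>" "\<nn> +> r \<in> carrier (R Quot \<nn>)"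
        using r n sub residue_eq_zero_iff by auto
      ultimately show "v \<nn> = \<zero>\<^bsub>R Quot \<nn>\<^esub>" using K.integral orbit_sum_component[OF v n(1)] by blast
    qed
  next
    assume Q: ?Q
    show ?L
    proof
      fix r assume r: "r \<in> \<mm>"
      then have rc: "r \<in> carrier R" using sub by auto
      show "r \<odot>\<^bsub>R\<omega>\<^esub> v = \<zero>\<^bsub>R\<omega>\<^esub>"
      proof (rule orbit_sum_eqI)
        fix \<nn> assume n: "\<nn> \<in> \<omega>"
        have "\<nn> = \<mm> \<Longrightarrow> \<nn> +> r = \<zero>\<^bsub>R Quot \<nn>\<^esub>" using residue_eq_zero_iff[OF n rc] r by simp
        then show "(r \<odot>\<^bsub>R\<omega>\<^esub> v) \<nn> = \<zero>\<^bsub>R\<omega>\<^esub> \<nn>"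
          using Q n v rc by (cases "\<nn> = \<mm>") (simp_all add: ring.ring_simprules[OF residue_ring])
      qed (use v rc in simp_all)
    qed
  qed
  show ?thesis unfolding weight_space_def orbit_module_simps
  proof (intro Collect_cong conj_cong HOL.refl)
    fix v assume v: "v \<in> carrier R\<omega>"
    have "(\<forall>r\<in>\<mm>. gwa_coef R \<sigma> t r \<odot>\<^bsub>V\<^esub> v = \<zero>\<^bsub>R\<omega>\<^esub>) \<longleftrightarrow> (\<forall>r\<in>\<mm>. r \<odot>\<^bsub>R\<omega>\<^esub> v = \<zero>\<^bsub>R\<omega>\<^esub>)"
      using sub v by (intro ball_cong HOL.refl) (simp add: subset_eq)
    with iff[OF v]
    show "(\<forall>r\<in>\<mm>. gwa_coef R \<sigma> t r \<odot>\<^bsub>V\<^esub> v = \<zero>\<^bsub>R\<omega>\<^esub>) \<longleftrightarrow>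
        (\<forall>\<nn>\<in>\<omega>. \<nn> \<noteq> \<mm> \<longrightarrow> v \<nn> = \<zero>\<^bsub>R Quot \<nn>\<^esub>)" by simp
  qed
qed

lemma weight_vector_apply:
  "\<mm> \<in> max_spec R \<Longrightarrow> v \<in> weight_space R \<sigma> t V \<mm> \<Longrightarrow> \<nn> \<in> \<omega> \<Longrightarrow> \<nn> \<noteq> \<mm> \<Longrightarrow> v \<nn> = \<zero>\<^bsub>R Quot \<nn>\<^esub>"
  by (simp add: weight_space_orbit_module)

lemma weight_support_orbit_module: "weight_support R \<sigma> t V \<subseteq> \<omega>"
proof -
  have "weight_space R \<sigma> t V \<mm> = {\<zero>\<^bsub>R\<omega>\<^esub>}" if "\<mm> \<in> max_spec R" "\<mm> \<notin> \<omega>" for \<mm>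
    unfolding weight_space_orbit_module[OF that(1)]
    using that(2) orbit_sum_zero_closed by (auto intro!: orbit_sum_eqI)
  then show ?thesis by (auto simp: weight_support_def)
qed

text \<open>At \<nn> only the summand of weight \<nn> can contribute. This reads a weight component
  off a sum and so gives uniqueness of the decomposition.\<close>

lemma finsum_weight_vectors_apply:
  assumes "finite A" "A \<subseteq> max_spec R" "\<And>\<mm>. \<mm> \<in> A \<Longrightarrow> b \<mm> \<in> weight_space R \<sigma> t V \<mm>" "\<nn> \<in> \<omega>"
  shows "(\<Oplus>\<^bsub>V\<^esub>\<mm>\<in>A. b \<mm>) \<nn> = (if \<nn> \<in> A then b \<nn> \<nn> else \<zero>\<^bsub>R Quot \<nn>\<^esub>)"
proof -
  interpret V: left_module "gwa R \<sigma> t" V by (rule orbit_module_left_module)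
  show ?thesis using assms(1-3)
  proof induction
    case (insert \<mm> A)
    then have b: "b \<mm>' \<in> carrier R\<omega>" if "\<mm>' \<in> insert \<mm> A" for \<mm>'
      using that by (auto simp: weight_space_def)
    have "(\<Oplus>\<^bsub>V\<^esub>\<mm>\<in>insert \<mm> A. b \<mm>) = b \<mm> \<oplus>\<^bsub>R\<omega>\<^esub> (\<Oplus>\<^bsub>V\<^esub>\<mm>\<in>A. b \<mm>)"
      using V.finsum_insert[of A \<mm> b] insert b by simp
    moreover have "\<nn> \<noteq> \<mm> \<Longrightarrow> b \<mm> \<nn> = \<zero>\<^bsub>R Quot \<nn>\<^esub>"
      
      using weight_vector_apply[of \<mm> "b \<mm>" \<nn>] insert.prems assms(4) by simp
    ultimately show ?case
      using insert b assms(4)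
      by (cases "\<nn> = \<mm>") (auto simp: ring.ring_simprules[OF residue_ring])
  qed (simp add: assms(4))
qed

lemma weight_module_orbit_module: "weight_module R \<sigma> t V"
  unfolding weight_module_def
proof (intro conjI orbit_module_left_module ballI)
  fix v assume "v \<in> carrier V"
  then have v: "v \<in> carrier R\<omega>" by simp
  interpret M: module R R\<omega> by (rule orbit_sum_module)
  interpret V: left_module "gwa R \<sigma> t" V by (rule orbit_module_left_module)
  let ?W = "\<Pi>\<^sub>E \<mm>\<in>max_spec R. weight_space R \<sigma> t V \<mm>"
  let ?A = "\<lambda>b. {\<mm> \<in> max_spec R. b \<mm> \<noteq> \<zero>\<^bsub>V\<^esub>}"
  \<comment> \<open>If \<open>b \<nn>\<close> is the zero vector, the index \<nn> is missing from
    the sum, but then \<open>b \<nn> \<nn>\<close> is zero as well, so one formula covers both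
    cases.\<close>
  have comp: "(\<Oplus>\<^bsub>V\<^esub>\<mm>\<in>?A b. b \<mm>) \<nn> = b \<nn> \<nn>" if "b \<in> ?W" "finite (?A b)" "\<nn> \<in> \<omega>" for b \<nn>
    using finsum_weight_vectors_apply[OF that(2) _ _ that(3), of b] that orbit_subset_max_spec
    by (auto simp: PiE_iff)
  \<comment> \<open>The family runs over all maximal ideals; outside the orbit the weight spaces are
    zero, which dictates the second branch.\<close>
  define b0 where "b0 = (\<lambda>\<mm>\<in>max_spec R. if \<mm> \<in> \<omega> then single \<mm> (v \<mm>) else \<zero>\<^bsub>R\<omega>\<^esub>)"
  have b0W: "b0 \<in> ?W"
    using v by (auto simp: b0_def weight_space_orbit_module single_closed single_apply)
  have "?A b0 \<subseteq> {\<mm> \<in> \<omega>. v \<mm> \<noteq> \<zero>\<^bsub>R Quot \<mm>\<^esub>}"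
  proof clarsimp
    fix \<mm> assume m: "\<mm> \<in> max_spec R" and b: "b0 \<mm> \<noteq> \<zero>\<^bsub>R\<omega>\<^esub>"
    have "single \<mm> \<zero>\<^bsub>R Quot \<mm>\<^esub> = \<zero>\<^bsub>R\<omega>\<^esub>" if "\<mm> \<in> \<omega>"
      using that
      by (intro orbit_sum_eqI single_closed) (auto simp: single_apply ring.ring_simprules[OF residue_ring])
    with m b show "\<mm> \<in> \<omega> \<and> v \<mm> \<noteq> \<zero>\<^bsub>R Quot \<mm>\<^esub>"
      by (auto simp: b0_def split: if_splits)
  qed
  then have fin: "finite (?A b0)" using orbit_sum_support[OF v] finite_subset by blast
  have sum: "(\<Oplus>\<^bsub>V\<^esub>\<mm>\<in>?A b. b \<mm>) \<in> carrier R\<omega>" if "b \<in> ?W" for b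
    using that V.finsum_closed[of b "?A b"] by (auto simp: PiE_iff weight_space_def)
  show "\<exists>!b. b \<in> ?W \<and> finite (?A b) \<and> v = (\<Oplus>\<^bsub>V\<^esub>\<mm>\<in>?A b. b \<mm>)"
  proof (rule ex1I[of _ b0])
    have "v = (\<Oplus>\<^bsub>V\<^esub>\<mm>\<in>?A b0. b0 \<mm>)"
      by (rule orbit_sum_eqI[OF v sum[OF b0W]])
        (use comp[OF b0W fin] orbit_subset_max_spec in \<open>auto simp: b0_def single_apply\<close>)
    then show "b0 \<in> ?W \<and> finite (?A b0) \<and> v = (\<Oplus>\<^bsub>V\<^esub>\<mm>\<in>?A b0. b0 \<mm>)"
      using b0W fin by blast
  next
    fix b assume b: "b \<in> ?W \<and> finite (?A b) \<and> v = (\<Oplus>\<^bsub>V\<^esub>\<mm>\<in>?A b. b \<mm>)"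
    show "b = b0"
    proof (rule PiE_ext)
      show "b \<in> ?W" "b0 \<in> ?W" using b b0W by auto
      fix \<mm> assume m: "\<mm> \<in> max_spec R"
      then have w: "b \<mm> \<in> weight_space R \<sigma> t V \<mm>" "b0 \<mm> \<in> weight_space R \<sigma> t V \<mm>"
        using b b0W by auto
      show "b \<mm> = b0 \<mm>"
      proof (rule orbit_sum_eqI)
        fix \<nn> assume n: "\<nn> \<in> \<omega>"
        show "b \<mm> \<nn> = b0 \<mm> \<nn>"
        proof (cases "\<nn> = \<mm>")
          case True
          have "v \<nn> = b \<nn> \<nn>" using b comp[of b \<nn>] n by simp
          moreover have "b0 \<nn> \<nn> = v \<nn>" using n orbit_subset_max_spec by (auto simp: b0_def single_apply)
          ultimately show ?thesis using True by simp
        next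
          case False
          then show ?thesis using weight_vector_apply[OF m _ n] w by metis
        qed
      qed (use w in \<open>auto simp: weight_space_def\<close>)
    qed
  qed
qed

section \<open>Infinite orbits indexed by the integers, and the coefficients\<close>

lemma image_sigma_eq_zero_iff:
  assumes "\<mm> \<in> \<omega>" "x \<in> carrier (R Quot \<mm>)"
  shows "\<sigma> ` x = \<zero>\<^bsub>R Quot (\<sigma> ` \<mm>)\<^esub> \<longleftrightarrow> x = \<zero>\<^bsub>R Quot \<mm>\<^esub>"
  unfolding residue_zero
  using inj_on_image_eq_iff[of \<sigma> "carrier R" x \<mm>] sigma_bij residue_subset[OF assms] orbit_subset[OF assms(1)]
  by (simp add: bij_betw_def)

text \<open>A coincidence at j < k makes the enumeration periodic with period p = k - j; reduction
  modulo p then shows that the orbit has at most p elements.\<close>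

lemma infinite_orbit_enum:
  assumes "infinite \<omega>"
  obtains \<mm> where "inj \<mm>" and "\<omega> = range \<mm>" and "\<And>n::int. \<sigma> ` \<mm> n = \<mm> (n + 1)"
proof -
  obtain \<mm> where \<omega>: "\<omega> = range \<mm>" and succ: "\<And>n::int. \<sigma> ` \<mm> n = \<mm> (n + 1)"
    and shift: "\<And>j k n. \<mm> j = \<mm> k \<Longrightarrow> \<mm> (n + j) = \<mm> (n + k)"
    by (rule orbit_enum) blast
  have "\<not> j < k" if jk: "\<mm> j = \<mm> k" for j k
  proof
    assume less: "j < k"
    define p where "p = k - j"
    have per: "\<mm> (n + p) = \<mm> n" for n
      using shift[OF jk, of "n - j"] by (simp add: p_def algebra_simps)
    have perq: "\<mm> (n + p * q) = \<mm> n" for n q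
    proof (induction q rule: int_induct[where k = 0])
      case (step1 i)
      then show ?case using per[of "n + p * i"] by (simp add: algebra_simps)
    next
      case (step2 i)
      then show ?case using per[of "n + p * (i - 1)"] by (simp add: algebra_simps)
    qed simp
    have "\<mm> n \<in> \<mm> ` {0..<p}" for n
    proof
      show "\<mm> n = \<mm> (n mod p)" using perq[of "n mod p" "n div p"] by simp
      show "n mod p \<in> {0..<p}" using less by (simp add: p_def)
    qed
    then have "\<omega> \<subseteq> \<mm> ` {0..<p}" using \<omega> by auto
    then show False using assms finite_subset by blast
  qed
  then have "inj \<mm>" by (intro injI) (metis linorder_neqE)
  then show thesis using that \<omega> succ by blast
qed

text \<open>The recursion that \<open>F(Xv, w) = \<sigma>(F(v, Yw))\<close> forces on the coefficients of a diagonal form.\<close>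

lemma form_coefficients_exist:
  assumes "infinite \<omega>" and nobreak: "breaks t \<omega> = {}"
  obtains c where "\<And>\<mm>. \<mm> \<in> \<omega> \<Longrightarrow> c \<mm> \<in> carrier (R Quot \<mm>) - {\<zero>\<^bsub>R Quot \<mm>\<^esub>}"
    and "\<And>\<mm>. \<mm> \<in> \<omega> \<Longrightarrow>
      c (\<sigma> ` \<mm>) \<otimes>\<^bsub>R Quot (\<sigma> ` \<mm>)\<^esub> (\<sigma> ` \<mm> +> \<sigma> t) = \<sigma> ` c \<mm>"
proof -
  obtain \<mm> where inj: "inj \<mm>" and \<omega>: "\<omega> = range \<mm>" and succ: "\<And>n::int. \<sigma> ` \<mm> n = \<mm> (n + 1)"
    using infinite_orbit_enum[OF assms(1)] by blast
  have m: "\<mm> n \<in> \<omega>" for n using \<omega> by simp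
  define N where "N n = carrier (R Quot \<mm> n) - {\<zero>\<^bsub>R Quot \<mm> n\<^esub>}" for n
  \<comment> \<open>\<open>u n\<close> is the residue of \<sigma>(t) at the ideal with index n + 1,
    that is, the image under \<sigma> of the residue of t at index n. Absence of breaks makes it
    nonzero, and \<open>h n\<close> is the recursion solved for the coefficient at n + 1 by dividing
    by it.\<close>
  define u where "u n = \<mm> (n + 1) +> \<sigma> t" for n
  define h where "h n x = \<sigma> ` x \<otimes>\<^bsub>R Quot \<mm> (n + 1)\<^esub> inv\<^bsub>R Quot \<mm> (n + 1)\<^esub> u n" for n x
  have Units: "Units (R Quot \<mm> n) = N n" for n
    unfolding N_def by (rule field.field_Units[OF residue_field[OF m]])
  have mon: "Group.monoid (R Quot \<mm> n)" for n by (rule residue_monoid[OF m])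
  have u: "u n \<in> N (n + 1)" for n
  proof -
    have "t \<notin> \<mm> n" using nobreak m by (auto simp: breaks_def)
    then have "\<mm> n +> t \<noteq> \<zero>\<^bsub>R Quot \<mm> n\<^esub>" using residue_eq_zero_iff[OF m t_closed] by simp
    then have "\<sigma> ` (\<mm> n +> t) \<noteq> \<zero>\<^bsub>R Quot (\<sigma> ` \<mm> n)\<^esub>"
      using image_sigma_eq_zero_iff[OF m] residue_closed[OF m t_closed] by simp
    then show ?thesis
      using residue_closed[OF m sigma_closed[OF t_closed]]
      by (simp add: N_def u_def image_sigma_coset[OF m t_closed] succ)
  qed
  have sN: "(`) \<sigma> ` N n = N (n + 1)" for n
  proof -
    have car: "(`) \<sigma> ` carrier (R Quot \<mm> n) = carrier (R Quot \<mm> (n + 1))"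
      using image_sigma_iso[OF m, of n] by (simp add: ring_iso_def bij_betw_def succ)
    have iff: "\<sigma> ` x = \<zero>\<^bsub>R Quot \<mm> (n + 1)\<^esub> \<longleftrightarrow> x = \<zero>\<^bsub>R Quot \<mm> n\<^esub>"
      if "x \<in> carrier (R Quot \<mm> n)" for x
      using image_sigma_eq_zero_iff[OF m that] by (simp add: succ)
    have diff: "f ` (A - {a}) = B - {b}"
      if "f ` A = B" "\<And>x. x \<in> A \<Longrightarrow> f x = b \<longleftrightarrow> x = a"
      for f :: "'r set \<Rightarrow> 'r set" and A B a b using that by blast
    show ?thesis unfolding N_def by (rule diff[OF car iff])
  qed
  have hN: "h n ` N n = N (n + 1)" for n
  proof -
    let ?K = "R Quot \<mm> (n + 1)"
    interpret K: Group.monoid ?K by (rule mon)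
    have uU: "u n \<in> Units ?K" using u Units by simp
    have "(\<lambda>y. y \<otimes>\<^bsub>?K\<^esub> inv\<^bsub>?K\<^esub> u n) ` Units ?K = Units ?K"
    proof (intro equalityI subsetI)
      fix y assume y: "y \<in> Units ?K"
      have "y = (y \<otimes>\<^bsub>?K\<^esub> u n) \<otimes>\<^bsub>?K\<^esub> inv\<^bsub>?K\<^esub> u n"
        using y uU by (simp add: K.m_assoc K.Units_closed)
      then show "y \<in> (\<lambda>y. y \<otimes>\<^bsub>?K\<^esub> inv\<^bsub>?K\<^esub> u n) ` Units ?K"
        using y uU K.Units_m_closed by blast
    qed (use uU in \<open>auto intro: K.Units_m_closed\<close>)
    then have "(\<lambda>y. y \<otimes>\<^bsub>?K\<^esub> inv\<^bsub>?K\<^esub> u n) ` (`) \<sigma> ` N n = N (n + 1)"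
      unfolding sN Units .
    moreover have "h n = (\<lambda>x. \<sigma> ` x \<otimes>\<^bsub>?K\<^esub> inv\<^bsub>?K\<^esub> u n)" by (rule ext) (rule h_def)
    ultimately show ?thesis by (simp only: image_image)
  qed
  \<comment> \<open>The starting value is free. The unit \<open>u (- 1)\<close> is merely a nonzero
    element at hand in the residue field at index 0.\<close>
  have "\<exists>e. e \<in> N 0" using u[of "- 1"] by auto
  then obtain d where d: "\<And>n. d n \<in> N n" "\<And>n. d (n + 1) = h n (d n)"
    using int_sequence_exists[of _ N h] hN by metis
  \<comment> \<open>Injectivity of the enumeration allows the values to be indexed by ideals instead
    of integers.\<close>
  define c where "c \<nn> = d (inv_into UNIV \<mm> \<nn>)" for \<nn>
  have c: "c (\<mm> n) = d n" for n using inj by (simp add: c_def)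
  show thesis
  proof
    fix \<nn> assume "\<nn> \<in> \<omega>"
    then obtain n where n: "\<nn> = \<mm> n" using \<omega> by auto
    show "c \<nn> \<in> carrier (R Quot \<nn>) - {\<zero>\<^bsub>R Quot \<nn>\<^esub>}" using d(1)[of n] by (simp add: n c N_def)
    let ?K = "R Quot \<mm> (n + 1)"
    interpret K: Group.monoid ?K by (rule mon)
    have "\<sigma> ` d n \<in> carrier ?K" using image_sigma_closed[OF m] d(1)[of n] by (simp add: N_def succ flip: succ)
    moreover have "u n \<in> Units ?K" using u Units by simp
    ultimately have "d (n + 1) \<otimes>\<^bsub>?K\<^esub> u n = \<sigma> ` d n"
      by (simp add: d(2) h_def K.m_assoc K.Units_closed)
    then show "c (\<sigma> ` \<nn>) \<otimes>\<^bsub>R Quot (\<sigma> ` \<nn>)\<^esub> (\<sigma> ` \<nn> +> \<sigma> t) = \<sigma> ` c \<nn>"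
      by (simp add: n succ c u_def)
  qed
qed

end

section \<open>The diagonal form\<close>

text \<open>The infinite orbit without breaks has been turned into a nonvanishing solution c of the
  recursion. Fixing c as a parameter separates the algebra of the diagonal form from the choices
  made in constructing c.\<close>

locale gwa_orbit_form = gwa_orbit R star \<sigma> t \<omega>
  for R :: "('r, 'x) ring_scheme" (structure) and star \<sigma> t \<omega> +
  fixes c :: "'r set \<Rightarrow> 'r set"
  assumes real: "real_orbit star \<omega>"
    and c_nonzero: "\<mm> \<in> \<omega> \<Longrightarrow> c \<mm> \<in> carrier (R Quot \<mm>) - {\<zero>\<^bsub>R Quot \<mm>\<^esub>}"
    and c_sigma: "\<mm> \<in> \<omega> \<Longrightarrow>
      c (\<sigma> ` \<mm>) \<otimes>\<^bsub>R Quot (\<sigma> ` \<mm>)\<^esub> (\<sigma> ` \<mm> +> \<sigma> t) = \<sigma> ` c \<mm>"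
begin

lemma c_closed [simp]: "\<mm> \<in> \<omega> \<Longrightarrow> c \<mm> \<in> carrier (R Quot \<mm>)"
  using c_nonzero by blast

lemma star_closed [simp]: "r \<in> carrier R \<Longrightarrow> star r \<in> carrier R"
  using star_iso by (auto simp: ring_iso_def bij_betw_def)

lemma star_image [simp]: "\<mm> \<in> \<omega> \<Longrightarrow> star ` \<mm> = \<mm>"
  using real by (simp add: real_orbit_def)

text \<open>Realness enters here: since star preserves \<mm>, it induces an automorphism of R/\<mm>
  rather than a map to another residue field.\<close>

lemma image_star_iso: "\<mm> \<in> \<omega> \<Longrightarrow> (`) star \<in> ring_iso (R Quot \<mm>) (R Quot \<mm>)"
  using ring_iso_image_Quot[OF star_iso orbit_ideal] by simp

lemma image_star_closed [simp]:
    "\<mm> \<in> \<omega> \<Longrightarrow> x \<in> carrier (R Quot \<mm>) \<Longrightarrow> star ` x \<in> carrier (R Quot \<mm>)"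
  and image_star_add: "\<mm> \<in> \<omega> \<Longrightarrow> x \<in> carrier (R Quot \<mm>) \<Longrightarrow> y \<in> carrier (R Quot \<mm>) \<Longrightarrow>
    star ` (x \<oplus>\<^bsub>R Quot \<mm>\<^esub> y) = star ` x \<oplus>\<^bsub>R Quot \<mm>\<^esub> star ` y"
  and image_star_mult: "\<mm> \<in> \<omega> \<Longrightarrow> x \<in> carrier (R Quot \<mm>) \<Longrightarrow> y \<in> carrier (R Quot \<mm>) \<Longrightarrow>
    star ` (x \<otimes>\<^bsub>R Quot \<mm>\<^esub> y) = star ` x \<otimes>\<^bsub>R Quot \<mm>\<^esub> star ` y"
  and image_star_one: "\<mm> \<in> \<omega> \<Longrightarrow> star ` \<one>\<^bsub>R Quot \<mm>\<^esub> = \<one>\<^bsub>R Quot \<mm>\<^esub>"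
  using ring_iso_memE[OF image_star_iso] by auto

lemma image_star_coset: "\<mm> \<in> \<omega> \<Longrightarrow> r \<in> carrier R \<Longrightarrow> star ` (\<mm> +> r) = \<mm> +> star r"
  using ring_iso_image_coset[OF star_iso orbit_subset] by simp

lemma image_star_zero: "\<mm> \<in> \<omega> \<Longrightarrow> star ` \<zero>\<^bsub>R Quot \<mm>\<^esub> = \<zero>\<^bsub>R Quot \<mm>\<^esub>"
  by (simp add: residue_zero)

lemma image_star_star: "A \<subseteq> carrier R \<Longrightarrow> star ` star ` A = A"
  by (force simp: image_iff subset_eq star_star)

text \<open>The commutation of \<sigma> and star, at the level of cosets. It exhibits the conjugate
  of a component at \<sigma>(\<nn>) as the \<sigma>-image of a conjugate at \<nn>, as needed to
  compare the two sides of the X-condition.\<close>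

lemma image_sigma_star_sigma_inv:
  assumes "A \<subseteq> carrier R" shows "\<sigma> ` star ` \<sigma>i ` A = star ` A"
proof -
  have "\<sigma> (star (\<sigma>i a)) = star a" if "a \<in> A" for a
    using assms that sigma_star[of "\<sigma>i a"] by (simp add: subset_eq)
  then show ?thesis by (simp add: image_image)
qed

section \<open>Sesquilinearity and the conditions for X and Y\<close>

definition form :: "('r set \<Rightarrow> 'r set) \<Rightarrow> ('r set \<Rightarrow> 'r set) \<Rightarrow> 'r set \<Rightarrow> 'r set" where
  "form v w = (\<lambda>\<mm>\<in>\<omega>. c \<mm> \<otimes>\<^bsub>R Quot \<mm>\<^esub> (v \<mm> \<otimes>\<^bsub>R Quot \<mm>\<^esub> star ` w \<mm>))"

lemma form_apply:
  "\<mm> \<in> \<omega> \<Longrightarrow> form v w \<mm> = c \<mm> \<otimes>\<^bsub>R Quot \<mm>\<^esub> (v \<mm> \<otimes>\<^bsub>R Quot \<mm>\<^esub> star ` w \<mm>)"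
  by (simp add: form_def)

lemma form_closed:
  assumes "v \<in> carrier R\<omega>" "w \<in> carrier R\<omega>"
  shows "form v w \<in> carrier R\<omega>"
  unfolding form_def
  by (rule orbit_sum_memI[where A = "{\<mm> \<in> \<omega>. v \<mm> \<noteq> \<zero>\<^bsub>R Quot \<mm>\<^esub>}"])
    (use assms in \<open>auto simp: orbit_sum_support ring.ring_simprules[OF residue_ring]\<close>)

lemma form_add_left:
  assumes "v \<in> carrier R\<omega>" "v' \<in> carrier R\<omega>" "w \<in> carrier R\<omega>"
  shows "form (v \<oplus>\<^bsub>R\<omega>\<^esub> v') w = form v w \<oplus>\<^bsub>R\<omega>\<^esub> form v' w"
  using assms
  by (intro orbit_sum_eqI form_closed orbit_sum_add_closed)
    (auto simp: form_apply ring.ring_simprules[OF residue_ring])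

lemma form_add_right:
  assumes "v \<in> carrier R\<omega>" "w \<in> carrier R\<omega>" "w' \<in> carrier R\<omega>"
  shows "form v (w \<oplus>\<^bsub>R\<omega>\<^esub> w') = form v w \<oplus>\<^bsub>R\<omega>\<^esub> form v w'"
  using assms
  by (intro orbit_sum_eqI form_closed orbit_sum_add_closed)
    (auto simp: form_apply ring.ring_simprules[OF residue_ring] image_star_add)

lemma form_smult_left:
  assumes "r \<in> carrier R" "v \<in> carrier R\<omega>" "w \<in> carrier R\<omega>"
  shows "form (r \<odot>\<^bsub>R\<omega>\<^esub> v) w = r \<odot>\<^bsub>R\<omega>\<^esub> form v w"
  using assms
  by (intro orbit_sum_eqI form_closed orbit_sum_smult_closed)
    (auto simp: form_apply cring.cring_simprules[OF residue_cring])

lemma form_smult_right: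
  assumes "r \<in> carrier R" "v \<in> carrier R\<omega>" "w \<in> carrier R\<omega>"
  shows "form v (r \<odot>\<^bsub>R\<omega>\<^esub> w) = star r \<odot>\<^bsub>R\<omega>\<^esub> form v w"
  using assms
  by (intro orbit_sum_eqI form_closed orbit_sum_smult_closed)
    (auto simp: form_apply cring.cring_simprules[OF residue_cring] image_star_mult image_star_coset)

lemma form_X:
  assumes v: "v \<in> carrier R\<omega>" and w: "w \<in> carrier R\<omega>"
  shows "form (VX v) w = orbit_sigma R \<sigma> \<omega> (form v (VY w))"
proof (rule orbit_sum_eqI)
  have tv: "t \<odot>\<^bsub>R\<omega>\<^esub> v \<in> carrier R\<omega>" using v t_closed by (rule orbit_sum_smult_closed[rotated])
  show "form (VX v) w \<in> carrier R\<omega>" "orbit_sigma R \<sigma> \<omega> (form v (VY w)) \<in> carrier R\<omega>"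
    using v w tv by (simp_all add: form_closed orbit_sigma_closed orbit_sigma_inv_closed)
  fix \<mm> assume m: "\<mm> \<in> \<omega>"
  define \<nn> where "\<nn> = \<sigma>i ` \<mm>"
  have n: "\<nn> \<in> \<omega>" and mn: "\<sigma> ` \<nn> = \<mm>" using m by (simp_all add: \<nn>_def)
  interpret K: cring "R Quot \<mm>" by (rule residue_cring[OF m])
  have vn: "\<sigma> ` v \<nn> \<in> carrier (R Quot \<mm>)"
    using image_sigma_closed[OF n] v n mn by force
  have wn: "star ` \<sigma>i ` w \<mm> \<in> carrier (R Quot \<nn>)"
    using image_sigma_inv_closed[OF m] w m n by (simp add: \<nn>_def)
  have "form (VX v) w \<mm> =
      c \<mm> \<otimes>\<^bsub>R Quot \<mm>\<^esub> ((\<mm> +> \<sigma> t) \<otimes>\<^bsub>R Quot \<mm>\<^esub> \<sigma> ` v \<nn> \<otimes>\<^bsub>R Quot \<mm>\<^esub> star ` w \<mm>)"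
    using n v t_closed image_sigma_mult[OF n, of "\<nn> +> t" "v \<nn>"] image_sigma_coset[OF n t_closed]
    by (simp add: form_apply[OF m] orbit_sigma_apply[OF m] \<nn>_def[symmetric] mn)
  also have "\<dots> = c \<mm> \<otimes>\<^bsub>R Quot \<mm>\<^esub> (\<mm> +> \<sigma> t) \<otimes>\<^bsub>R Quot \<mm>\<^esub> (\<sigma> ` v \<nn> \<otimes>\<^bsub>R Quot \<mm>\<^esub> star ` w \<mm>)"
    using m vn w t_closed by (simp add: K.m_assoc)
  \<comment> \<open>The recursion for c is used here; all other factors match by semilinearity of
    \<sigma>.\<close>
  also have "c \<mm> \<otimes>\<^bsub>R Quot \<mm>\<^esub> (\<mm> +> \<sigma> t) = \<sigma> ` c \<nn>"
    using c_sigma[OF n] by (simp add: mn)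
  also have "star ` w \<mm> = \<sigma> ` star ` \<sigma>i ` w \<mm>"
    using image_sigma_star_sigma_inv[OF residue_subset[OF m]] w m by simp
  also have "\<sigma> ` c \<nn> \<otimes>\<^bsub>R Quot \<mm>\<^esub> (\<sigma> ` v \<nn> \<otimes>\<^bsub>R Quot \<mm>\<^esub> \<sigma> ` star ` \<sigma>i ` w \<mm>) =
      \<sigma> ` (c \<nn> \<otimes>\<^bsub>R Quot \<nn>\<^esub> (v \<nn> \<otimes>\<^bsub>R Quot \<nn>\<^esub> star ` \<sigma>i ` w \<mm>))"
    using image_sigma_mult[OF n] wn n v cring.cring_simprules(5)[OF residue_cring[OF n]] by (simp add: mn)
  also have "\<dots> = orbit_sigma R \<sigma> \<omega> (form v (VY w)) \<mm>"
    using n w by (simp add: orbit_sigma_apply[OF m] \<nn>_def[symmetric] form_apply orbit_sigma_inv_apply mn)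
  finally show "form (VX v) w \<mm> = orbit_sigma R \<sigma> \<omega> (form v (VY w)) \<mm>" .
qed

text \<open>The X-condition is applied to Yv and \<sigma>(w). It gives \<sigma>(F(Yv, w)) = F(XYv,
  \<sigma>(w)) = F(\<sigma>(t)v, \<sigma>(w)). As star fixes \<sigma>(t), this scalar moves to the
  second argument, where \<sigma>(t)\<sigma>(w) = \<sigma>(tw) = Xw.\<close>

lemma form_Y:
  assumes v: "v \<in> carrier R\<omega>" and w: "w \<in> carrier R\<omega>"
  shows "form (VY v) w = orbit_sigma_inv R \<sigma> \<omega> (form v (VX w))"
proof -
  have cl: "VY v \<in> carrier R\<omega>" "orbit_sigma R \<sigma> \<omega> w \<in> carrier R\<omega>"
    using v w by (simp_all add: orbit_sigma_inv_closed orbit_sigma_closed)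
  have st: "star (\<sigma> t) = \<sigma> t" using sigma_star[OF t_closed] star_t by simp
  have "orbit_sigma R \<sigma> \<omega> (form (VY v) w) = form (VX (VY v)) (orbit_sigma R \<sigma> \<omega> w)"
    using form_X[OF cl] w by (simp add: orbit_sigma_inv_left)
  also have "\<dots> = form v (\<sigma> t \<odot>\<^bsub>R\<omega>\<^esub> orbit_sigma R \<sigma> \<omega> w)"
    using orbit_module_relations(6)[OF v] form_smult_left[OF _ v cl(2)] form_smult_right[OF _ v cl(2)]
    by (simp add: t_closed st)
  also have "\<dots> = form v (VX w)" using w by (simp add: orbit_sigma_smult t_closed)
  finally show ?thesis
    using orbit_sigma_inv_eqI form_closed[OF cl(1) w] by simp
qed

section \<open>Non-degeneracy\<close>

lemma residue_cancel:
  assumes m: "\<mm> \<in> \<omega>" and x: "x \<in> carrier (R Quot \<mm>)" and y: "y \<in> carrier (R Quot \<mm>)"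
    and eq: "c \<mm> \<otimes>\<^bsub>R Quot \<mm>\<^esub> x = c \<mm> \<otimes>\<^bsub>R Quot \<mm>\<^esub> y"
  shows "x = y"
proof -
  interpret K: field "R Quot \<mm>" by (rule residue_field[OF m])
  show ?thesis using K.m_lcancel[of "c \<mm>" x y] c_nonzero[OF m] x y eq by simp
qed

lemma single_one_closed [simp]: "\<mm> \<in> \<omega> \<Longrightarrow> single \<mm> \<one>\<^bsub>R Quot \<mm>\<^esub> \<in> carrier R\<omega>"
  by (simp add: single_closed ring.ring_simprules[OF residue_ring])

lemma form_single_right:
  assumes "\<mm> \<in> \<omega>" "v \<in> carrier R\<omega>"
  shows "form v (single \<mm> \<one>\<^bsub>R Quot \<mm>\<^esub>) \<mm> = c \<mm> \<otimes>\<^bsub>R Quot \<mm>\<^esub> v \<mm>"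
  using assms
  by (simp add: form_apply single_apply image_star_one ring.ring_simprules[OF residue_ring]
      monoid.r_one[OF residue_monoid])

lemma form_single_left:
  assumes "\<mm> \<in> \<omega>" "v \<in> carrier R\<omega>"
  shows "form (single \<mm> \<one>\<^bsub>R Quot \<mm>\<^esub>) v \<mm> = c \<mm> \<otimes>\<^bsub>R Quot \<mm>\<^esub> star ` v \<mm>"
  using assms
  by (simp add: form_apply single_apply ring.ring_simprules[OF residue_ring]
      monoid.l_one[OF residue_monoid])

lemma form_nondegenerate: "nondegenerate_form R \<omega> V form"
  unfolding nondegenerate_form_def orbit_module_simps
proof (intro ballI impI)
  fix v assume v: "v \<in> carrier R\<omega>" and "v \<noteq> \<zero>\<^bsub>R\<omega>\<^esub>"
  then obtain \<mm> where m: "\<mm> \<in> \<omega>" "v \<mm> \<noteq> \<zero>\<^bsub>R Quot \<mm>\<^esub>"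
    using orbit_sum_eqI[OF v orbit_sum_zero_closed] by (metis orbit_sum_zero_apply)
  interpret K: field "R Quot \<mm>" by (rule residue_field[OF m(1)])
  \<comment> \<open>One test vector, the unit at an ideal where v does not vanish, detects v on both
    sides of the form.\<close>
  let ?w = "single \<mm> \<one>\<^bsub>R Quot \<mm>\<^esub>"
  have nz: "c \<mm> \<otimes>\<^bsub>R Quot \<mm>\<^esub> x \<noteq> \<zero>\<^bsub>R Quot \<mm>\<^esub>"
    if "x \<in> carrier (R Quot \<mm>)" "x \<noteq> \<zero>\<^bsub>R Quot \<mm>\<^esub>" for x
    using that residue_cancel[OF m(1) that(1), of "\<zero>\<^bsub>R Quot \<mm>\<^esub>"] m(1) by auto
  have "star ` v \<mm> \<noteq> \<zero>\<^bsub>R Quot \<mm>\<^esub>"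
    using image_star_star[OF residue_subset[OF m(1) orbit_sum_component[OF v m(1)]]]
      image_star_zero[OF m(1)] m(2) by metis
  then have "form ?w v \<mm> \<noteq> \<zero>\<^bsub>R\<omega>\<^esub> \<mm>" "form v ?w \<mm> \<noteq> \<zero>\<^bsub>R\<omega>\<^esub> \<mm>"
    using m v nz by (simp_all add: form_single_left form_single_right)
  then show "\<exists>w\<^sub>1\<in>carrier R\<omega>. \<exists>w\<^sub>2\<in>carrier R\<omega>. form w\<^sub>1 v \<noteq> \<zero>\<^bsub>R\<omega>\<^esub> \<and> form v w\<^sub>2 \<noteq> \<zero>\<^bsub>R\<omega>\<^esub>"
    using single_one_closed[OF m(1)] by metis
qed

text \<open>Writing negation as a scalar multiple lets the negation case of the induction over
  expressions be settled by semilinearity.\<close>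

lemma orbit_sum_a_inv: "v \<in> carrier R\<omega> \<Longrightarrow> \<ominus>\<^bsub>R\<omega>\<^esub> v = (\<ominus> \<one>) \<odot>\<^bsub>R\<omega>\<^esub> v"
proof -
  interpret M: module R R\<omega> by (rule orbit_sum_module)
  show "v \<in> carrier R\<omega> \<Longrightarrow> \<ominus>\<^bsub>R\<omega>\<^esub> v = (\<ominus> \<one>) \<odot>\<^bsub>R\<omega>\<^esub> v"
    using M.smult_l_minus[of \<one> v] by simp
qed

text \<open>Induction over homogeneous expressions reduces the condition to coefficients, X and Y.
  In the product case a is moved across first and then b, so the powers of \<sigma> compose to
  degree d + e and the starred factors appear in reversed order, as the anti-automorphism
  prescribes.\<close>

lemma form_homogeneous:
  assumes "gwa_homogeneous R d a" "v \<in> carrier R\<omega>" "w \<in> carrier R\<omega>"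
  shows "form (gwa_eval R\<omega> VX VY a v) w =
    orbit_sigma_pow R \<sigma> \<omega> d (form v (gwa_eval R\<omega> VX VY (gwa_term_star star a) w))"
  using assms
proof (induction arbitrary: v w)
  case (coef r)
  then show ?case by (simp add: orbit_sigma_pow_def form_smult_left form_smult_right star_star)
next
  case X
  then show ?case
    using bij_pow_succ[OF orbit_sigma_bij, of "form v (VY w)" 0]
    by (simp add: orbit_sigma_pow_def form_X form_closed orbit_sigma_inv_closed)
next
  case Y
  then have "VX w \<in> carrier R\<omega>" using orbit_module_relations(1) by auto
  with Y show ?case
    using bij_pow_pred[OF orbit_sigma_bij, of "form v (VX w)" 0]
    by (simp add: orbit_sigma_pow_def form_Y form_closed flip: orbit_sigma_inv_def)
next
  case (add d a b)
  note cl = gwa_eval_closed[OF orbit_eval_hyps] gwa_homogeneous_terms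
    gwa_term_star_terms[OF datum, THEN conjunct1]
  have "orbit_sigma_pow R \<sigma> \<omega> d (x \<oplus>\<^bsub>R\<omega>\<^esub> y) =
      orbit_sigma_pow R \<sigma> \<omega> d x \<oplus>\<^bsub>R\<omega>\<^esub> orbit_sigma_pow R \<sigma> \<omega> d y"
    if "x \<in> carrier R\<omega>" "y \<in> carrier R\<omega>" for x y
    unfolding orbit_sigma_pow_def
    by (rule bij_pow_hom[OF orbit_sigma_bij]) (simp_all add: orbit_sum_add_closed orbit_sigma_add that)
  with add show ?case by (simp add: cl form_add_left form_add_right form_closed)
next
  case (neg d a)
  note cl = gwa_eval_closed[OF orbit_eval_hyps] gwa_homogeneous_terms
    gwa_term_star_terms[OF datum, THEN conjunct1]
  have hom: "ring_hom_cring R R f" if "f \<in> ring_iso R R" for f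
    using that by (auto simp: ring_iso_def intro!: ring_hom_cringI is_cring)
  have one: "f (\<ominus> \<one>) = \<ominus> \<one>" if "f \<in> ring_iso R R" for f
  proof -
    interpret f: ring_hom_cring R R f by (rule hom[OF that])
    show ?thesis by simp
  qed
  \<comment> \<open>As \<sigma> fixes -1, its powers on the orbit sum commute with negation.\<close>
  have "orbit_sigma_pow R \<sigma> \<omega> d ((\<ominus> \<one>) \<odot>\<^bsub>R\<omega>\<^esub> x) = (\<ominus> \<one>) \<odot>\<^bsub>R\<omega>\<^esub> orbit_sigma_pow R \<sigma> \<omega> d x"
    if "x \<in> carrier R\<omega>" for x
    unfolding orbit_sigma_pow_def
    by (rule bij_pow_hom[OF orbit_sigma_bij, where g = "\<lambda>x y. (\<ominus> \<one>) \<odot>\<^bsub>R\<omega>\<^esub> x", OF _ _ that that])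
      (simp_all add: orbit_sum_smult_closed orbit_sigma_smult one[OF sigma_iso])
  with neg show ?case
    by (simp add: cl orbit_sum_a_inv form_smult_left form_smult_right form_closed one[OF star_iso])
next
  case (mul d a e b)
  note cl = gwa_eval_closed[OF orbit_eval_hyps] gwa_homogeneous_terms
    gwa_term_star_terms[OF datum, THEN conjunct1]
  from mul show ?case
    by (simp add: cl form_closed orbit_sigma_pow_def bij_pow_add[OF orbit_sigma_bij])
qed

lemma form_admissible: "admissible_form R star \<sigma> t \<omega> V form"
  unfolding admissible_form_def orbit_module_simps
proof (intro conjI ballI allI)
  fix d a v w assume a: "a \<in> gwa_component R \<sigma> t d" and v: "v \<in> carrier R\<omega>" and w: "w \<in> carrier R\<omega>"
  then obtain b where b: "gwa_homogeneous R d b" "a = gwa_class R \<sigma> t b"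
    by (auto simp: gwa_component_def)
  then have "b \<in> gwa_terms R" by (simp add: gwa_homogeneous_terms)
  then show "form (a \<odot>\<^bsub>V\<^esub> v) w = orbit_sigma_pow R \<sigma> \<omega> d (form v (gwa_star R star \<sigma> t a \<odot>\<^bsub>V\<^esub> w))"
    using form_homogeneous[OF b(1) v w] v w gwa_term_star_terms[OF datum]
    by (simp add: b(2) gwa_star_class[OF datum] orbit_module_smult)
qed (simp_all add: form_closed form_add_left form_add_right form_smult_left)

lemma orbit_module_pseudo_unitarizable: "pseudo_unitarizable R star \<sigma> t \<omega> V"
  unfolding pseudo_unitarizable_def
  using weight_module_orbit_module weight_support_orbit_module form_admissible form_nondegenerate
  by blast

end

section \<open>The finitistic dual\<close>

context gwa_orbit_form
begin

abbreviation "dual \<equiv> dual_carrier R star \<sigma> t \<omega> V"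

text \<open>The restriction to the carrier is forced by the encoding of the dual, whose elements are
  extensional functions.\<close>

definition form_map :: "('r set \<Rightarrow> 'r set) \<Rightarrow> ('r set \<Rightarrow> 'r set) \<Rightarrow> 'r set \<Rightarrow> 'r set" where
  "form_map u = (\<lambda>w\<in>carrier R\<omega>. form u w)"

lemma form_map_apply: "w \<in> carrier R\<omega> \<Longrightarrow> form_map u w = form u w"
  by (simp add: form_map_def)

lemma form_map_dual:
  assumes u: "u \<in> carrier R\<omega>"
  shows "form_map u \<in> dual"
  unfolding dual_carrier_def orbit_module_simps
proof (intro CollectI conjI ballI)
  interpret M: module R R\<omega> by (rule orbit_sum_module)
  show "form_map u \<in> carrier R\<omega> \<rightarrow>\<^sub>E carrier R\<omega>"
    using u by (auto simp: form_map_def form_closed)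
  show "form_map u (v \<oplus>\<^bsub>R\<omega>\<^esub> w) = form_map u v \<oplus>\<^bsub>R\<omega>\<^esub> form_map u w"
    if "v \<in> carrier R\<omega>" "w \<in> carrier R\<omega>" for v w
    using that u by (simp add: form_map_apply form_add_right)
  show "form_map u (gwa_coef R \<sigma> t r \<odot>\<^bsub>V\<^esub> v) = star r \<odot>\<^bsub>R\<omega>\<^esub> form_map u v"
    if "r \<in> carrier R" "v \<in> carrier R\<omega>" for r v
    using that u by (simp add: form_map_apply form_smult_right)
  \<comment> \<open>For v of weight \<mm> only the component at \<mm> of F(u, v) can be nonzero, and
    it contains the factor \<open>u \<mm>\<close>; hence the finite support of u bounds the set in
    question.\<close>
  have "{\<mm> \<in> \<omega>. \<exists>v\<in>weight_space R \<sigma> t V \<mm>. form_map u v \<noteq> \<zero>\<^bsub>R\<omega>\<^esub>} \<subseteq>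
      {\<mm> \<in> \<omega>. u \<mm> \<noteq> \<zero>\<^bsub>R Quot \<mm>\<^esub>}"
  proof clarify
    fix \<mm> v assume m: "\<mm> \<in> \<omega>" and v: "v \<in> weight_space R \<sigma> t V \<mm>"
      and nz: "form_map u v \<noteq> \<zero>\<^bsub>R\<omega>\<^esub>" and um: "u \<mm> = \<zero>\<^bsub>R Quot \<mm>\<^esub>"
    have mx: "\<mm> \<in> max_spec R" using m orbit_subset_max_spec by blast
    have vc: "v \<in> carrier R\<omega>" using v by (simp add: weight_space_def)
    have "form u v = \<zero>\<^bsub>R\<omega>\<^esub>"
    proof (rule orbit_sum_eqI)
      fix \<nn> assume n: "\<nn> \<in> \<omega>"
      interpret K: cring "R Quot \<nn>" by (rule residue_cring[OF n])
      show "form u v \<nn> = \<zero>\<^bsub>R\<omega>\<^esub> \<nn>"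
      proof (cases "\<nn> = \<mm>")
        case True
        then have "u \<nn> = \<zero>\<^bsub>R Quot \<nn>\<^esub>" using um by simp
        then show ?thesis using n vc by (simp add: form_apply)
      next
        case False
        then have "v \<nn> = \<zero>\<^bsub>R Quot \<nn>\<^esub>" using weight_vector_apply[OF mx v n] by simp
        then show ?thesis using n u image_star_zero[OF n] by (simp add: form_apply)
      qed
    qed (use u vc in \<open>simp_all add: form_closed\<close>)
    then show False using nz vc by (simp add: form_map_apply)
  qed
  then show "finite {\<mm> \<in> \<omega>. \<exists>v\<in>weight_space R \<sigma> t V \<mm>. form_map u v \<noteq> \<zero>\<^bsub>R\<omega>\<^esub>}"
    using orbit_sum_support[OF u] by (rule finite_subset)
qed

section \<open>Functionals in the dual act diagonally\<close>

lemma dual_closed: "\<phi> \<in> dual \<Longrightarrow> v \<in> carrier R\<omega> \<Longrightarrow> \<phi> v \<in> carrier R\<omega>"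
  and dual_add: "\<phi> \<in> dual \<Longrightarrow> v \<in> carrier R\<omega> \<Longrightarrow> w \<in> carrier R\<omega> \<Longrightarrow>
    \<phi> (v \<oplus>\<^bsub>R\<omega>\<^esub> w) = \<phi> v \<oplus>\<^bsub>R\<omega>\<^esub> \<phi> w"
  and dual_smult: "\<phi> \<in> dual \<Longrightarrow> r \<in> carrier R \<Longrightarrow> v \<in> carrier R\<omega> \<Longrightarrow>
    \<phi> (r \<odot>\<^bsub>R\<omega>\<^esub> v) = star r \<odot>\<^bsub>R\<omega>\<^esub> \<phi> v"
  and dual_finite: "\<phi> \<in> dual \<Longrightarrow>
    finite {\<mm> \<in> \<omega>. \<exists>v\<in>weight_space R \<sigma> t V \<mm>. \<phi> v \<noteq> \<zero>\<^bsub>R\<omega>\<^esub>}"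
  and dual_extensional: "\<phi> \<in> dual \<Longrightarrow> \<phi> \<in> extensional (carrier R\<omega>)"
proof -
  assume \<phi>: "\<phi> \<in> dual"
  show "v \<in> carrier R\<omega> \<Longrightarrow> \<phi> v \<in> carrier R\<omega>"
    "v \<in> carrier R\<omega> \<Longrightarrow> w \<in> carrier R\<omega> \<Longrightarrow> \<phi> (v \<oplus>\<^bsub>R\<omega>\<^esub> w) = \<phi> v \<oplus>\<^bsub>R\<omega>\<^esub> \<phi> w"
    "finite {\<mm> \<in> \<omega>. \<exists>v\<in>weight_space R \<sigma> t V \<mm>. \<phi> v \<noteq> \<zero>\<^bsub>R\<omega>\<^esub>}" "\<phi> \<in> extensional (carrier R\<omega>)"
    using \<phi> by (simp_all add: dual_carrier_def PiE_iff)
  show "\<phi> (r \<odot>\<^bsub>R\<omega>\<^esub> v) = star r \<odot>\<^bsub>R\<omega>\<^esub> \<phi> v" if "r \<in> carrier R" "v \<in> carrier R\<omega>"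
  proof -
    have "\<phi> (gwa_coef R \<sigma> t r \<odot>\<^bsub>V\<^esub> v) = star r \<odot>\<^bsub>R\<omega>\<^esub> \<phi> v"
      using \<phi> that unfolding dual_carrier_def orbit_module_simps by blast
    then show ?thesis using that by simp
  qed
qed

text \<open>A vector without component at \<open>\<nn>\<close> is killed by some \<open>r \<notin> \<nn>\<close>, and \<open>r\<^sup>*\<close> is invertible
  modulo \<open>\<nn>\<^sup>* = \<nn>\<close>.\<close>

lemma dual_local:
  assumes \<phi>: "\<phi> \<in> dual" and w: "w \<in> carrier R\<omega>" and n: "\<nn> \<in> \<omega>" and wn: "w \<nn> = \<zero>\<^bsub>R Quot \<nn>\<^esub>"
  shows "\<phi> w \<nn> = \<zero>\<^bsub>R Quot \<nn>\<^esub>"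
proof -
  interpret M: module R R\<omega> by (rule orbit_sum_module)
  interpret K: field "R Quot \<nn>" by (rule residue_field[OF n])
  let ?A = "{\<mm> \<in> \<omega>. w \<mm> \<noteq> \<zero>\<^bsub>R Quot \<mm>\<^esub>}"
  \<comment> \<open>The support of w is finite and misses \<nn>, so r can be taken in every ideal of
    the support but outside \<nn>.\<close>
  obtain r where r: "r \<in> carrier R" "r \<notin> \<nn>" and rA: "\<And>\<mm>. \<mm> \<in> ?A \<Longrightarrow> r \<in> \<mm>"
    using maximalideals_avoid[OF orbit_sum_support[OF w] orbit_maximal[OF n]] wn orbit_maximal by auto
  have "r \<odot>\<^bsub>R\<omega>\<^esub> w = \<zero>\<^bsub>R\<omega>\<^esub>"
  proof (rule orbit_sum_eqI)
    fix \<mm> assume m: "\<mm> \<in> \<omega>"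
    interpret L: cring "R Quot \<mm>" by (rule residue_cring[OF m])
    have "\<mm> +> r = \<zero>\<^bsub>R Quot \<mm>\<^esub> \<or> w \<mm> = \<zero>\<^bsub>R Quot \<mm>\<^esub>"
      using rA[of \<mm>] m residue_eq_zero_iff[OF m r(1)] by auto
    then show "(r \<odot>\<^bsub>R\<omega>\<^esub> w) \<mm> = \<zero>\<^bsub>R\<omega>\<^esub> \<mm>"
    proof
      assume "\<mm> +> r = \<zero>\<^bsub>R Quot \<mm>\<^esub>"
      then show ?thesis using m w by simp
    next
      assume "w \<mm> = \<zero>\<^bsub>R Quot \<mm>\<^esub>"
      then show ?thesis using m r(1) by simp
    qed
  qed (use r w in simp_all)
  \<comment> \<open>Zero is presented as a scalar multiple of w so that star-linearity of
    \<open>\<phi>\<close> applies to both sides and yields that star r kills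
    \<open>\<phi> w\<close>.\<close>
  also have "\<dots> = \<zero> \<odot>\<^bsub>R\<omega>\<^esub> w" using w by (simp add: M.smult_l_null)
  finally have "r \<odot>\<^bsub>R\<omega>\<^esub> w = \<zero> \<odot>\<^bsub>R\<omega>\<^esub> w" .
  then have "star r \<odot>\<^bsub>R\<omega>\<^esub> \<phi> w = star \<zero> \<odot>\<^bsub>R\<omega>\<^esub> \<phi> w"
    using dual_smult[OF \<phi> r(1) w] dual_smult[OF \<phi> zero_closed w] by simp
  moreover have "ring_hom_cring R R star"
    using star_iso by (auto simp: ring_iso_def intro!: ring_hom_cringI is_cring)
  ultimately have "star r \<odot>\<^bsub>R\<omega>\<^esub> \<phi> w = \<zero>\<^bsub>R\<omega>\<^esub>"
    using dual_closed[OF \<phi> w] by (simp add: ring_hom_cring.hom_zero M.smult_l_null)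
  then have "(\<nn> +> star r) \<otimes>\<^bsub>R Quot \<nn>\<^esub> \<phi> w \<nn> = \<zero>\<^bsub>R Quot \<nn>\<^esub>"
    using n by (metis orbit_sum_smult_apply orbit_sum_zero_apply)
  moreover have "\<nn> +> star r \<noteq> \<zero>\<^bsub>R Quot \<nn>\<^esub>"
  proof
    assume "\<nn> +> star r = \<zero>\<^bsub>R Quot \<nn>\<^esub>"
    then have "star r \<in> \<nn>" using residue_eq_zero_iff[OF n] r(1) by simp
    then have "star (star r) \<in> star ` \<nn>" by (rule imageI)
    then show False using star_image[OF n] star_star[OF r(1)] r(2) by simp
  qed
  ultimately show ?thesis
    using K.integral[of "\<nn> +> star r" "\<phi> w \<nn>"] residue_closed[OF n] r(1)
      orbit_sum_component[OF dual_closed[OF \<phi> w] n]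
    by (metis star_closed)
qed

text \<open>With r a lift of the component of w at \<nn>, the vector w splits into r times the unit
  vector at \<nn> and a remainder without component at \<nn>. By \<open>dual_local\<close> the
  remainder contributes nothing at \<nn>, and star-linearity evaluates the rest.\<close>

lemma dual_apply:
  assumes \<phi>: "\<phi> \<in> dual" and w: "w \<in> carrier R\<omega>" and n: "\<nn> \<in> \<omega>"
  shows "\<phi> w \<nn> = \<phi> (single \<nn> \<one>\<^bsub>R Quot \<nn>\<^esub>) \<nn> \<otimes>\<^bsub>R Quot \<nn>\<^esub> star ` w \<nn>"
proof -
  interpret M: module R R\<omega> by (rule orbit_sum_module)
  interpret K: field "R Quot \<nn>" by (rule residue_field[OF n])
  let ?e = "single \<nn> \<one>\<^bsub>R Quot \<nn>\<^esub>"
  obtain r where r: "r \<in> carrier R" "w \<nn> = \<nn> +> r"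
    using residueE[OF n orbit_sum_component[OF w n]] .
  let ?w' = "w \<oplus>\<^bsub>R\<omega>\<^esub> \<ominus>\<^bsub>R\<omega>\<^esub> (r \<odot>\<^bsub>R\<omega>\<^esub> ?e)"
  have e: "?e \<in> carrier R\<omega>" using n by simp
  have w': "?w' \<in> carrier R\<omega>" using w r e by simp
  have dec: "w = ?w' \<oplus>\<^bsub>R\<omega>\<^esub> r \<odot>\<^bsub>R\<omega>\<^esub> ?e"
    using w r e by (simp add: M.a_assoc M.l_neg)
  have en: "(r \<odot>\<^bsub>R\<omega>\<^esub> ?e) \<nn> = w \<nn>" using n r by (simp add: single_apply)
  have "w \<nn> = ?w' \<nn> \<oplus>\<^bsub>R Quot \<nn>\<^esub> w \<nn>"
    using dec n en by (metis orbit_sum_add_apply)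
  then have "?w' \<nn> = \<zero>\<^bsub>R Quot \<nn>\<^esub>"
    by (rule iffD1[OF K.add.r_cancel_one'[OF orbit_sum_component[OF w n] orbit_sum_component[OF w' n]]])
  then have "\<phi> ?w' \<nn> = \<zero>\<^bsub>R Quot \<nn>\<^esub>" by (rule dual_local[OF \<phi> w' n])
  moreover have "\<phi> w \<nn> = \<phi> ?w' \<nn> \<oplus>\<^bsub>R Quot \<nn>\<^esub> (\<nn> +> star r) \<otimes>\<^bsub>R Quot \<nn>\<^esub> \<phi> ?e \<nn>"
  proof -
    have "\<phi> w = \<phi> ?w' \<oplus>\<^bsub>R\<omega>\<^esub> star r \<odot>\<^bsub>R\<omega>\<^esub> \<phi> ?e"
      using dual_add[OF \<phi> w'] dual_smult[OF \<phi> r(1) e] dec r e by (metis M.smult_closed)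
    then show ?thesis using n by simp
  qed
  moreover have "star ` w \<nn> = \<nn> +> star r" using image_star_coset[OF n r(1)] r(2) by simp
  ultimately show ?thesis
    using K.m_comm dual_closed[OF \<phi> e] n r(1) by simp
qed

lemma form_map_bij: "bij_betw form_map (carrier R\<omega>) dual"
proof (rule bij_betw_imageI)
  show "inj_on form_map (carrier R\<omega>)"
  proof (intro inj_onI orbit_sum_eqI)
    fix u u' \<mm> assume u: "u \<in> carrier R\<omega>" "u' \<in> carrier R\<omega>" "form_map u = form_map u'"
      and m: "\<mm> \<in> \<omega>"
    then have "form u (single \<mm> \<one>\<^bsub>R Quot \<mm>\<^esub>) = form u' (single \<mm> \<one>\<^bsub>R Quot \<mm>\<^esub>)"
      by (metis form_map_apply single_one_closed)
    then have "c \<mm> \<otimes>\<^bsub>R Quot \<mm>\<^esub> u \<mm> = c \<mm> \<otimes>\<^bsub>R Quot \<mm>\<^esub> u' \<mm>"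
      using form_single_right[OF m] u by metis
    then show "u \<mm> = u' \<mm>" using residue_cancel[OF m] u m by simp
  qed
  show "form_map ` carrier R\<omega> = dual"
  proof (intro equalityI subsetI)
    fix \<phi> assume \<phi>: "\<phi> \<in> dual"
    let ?e = "\<lambda>\<mm>. single \<mm> \<one>\<^bsub>R Quot \<mm>\<^esub>"
    let ?A = "{\<mm> \<in> \<omega>. \<exists>v\<in>weight_space R \<sigma> t V \<mm>. \<phi> v \<noteq> \<zero>\<^bsub>R\<omega>\<^esub>}"
    \<comment> \<open>The equation F(u, -) = \<open>\<phi>\<close>, tested on the unit vector at
      \<mm>, prescribes \<open>c \<mm>\<close> times \<open>u \<mm>\<close>; division by
      \<open>c \<mm>\<close> leaves this as the only candidate.\<close>
    define u where "u = (\<lambda>\<mm>\<in>\<omega>. inv\<^bsub>R Quot \<mm>\<^esub> c \<mm> \<otimes>\<^bsub>R Quot \<mm>\<^esub> \<phi> (?e \<mm>) \<mm>)"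
    have inv: "inv\<^bsub>R Quot \<mm>\<^esub> c \<mm> \<in> carrier (R Quot \<mm>)"
      "c \<mm> \<otimes>\<^bsub>R Quot \<mm>\<^esub> inv\<^bsub>R Quot \<mm>\<^esub> c \<mm> = \<one>\<^bsub>R Quot \<mm>\<^esub>" if m: "\<mm> \<in> \<omega>" for \<mm>
    proof -
      interpret K: field "R Quot \<mm>" by (rule residue_field[OF m])
      have "c \<mm> \<in> Units (R Quot \<mm>)" using c_nonzero[OF m] by (simp add: K.field_Units)
      then show "inv\<^bsub>R Quot \<mm>\<^esub> c \<mm> \<in> carrier (R Quot \<mm>)"
        "c \<mm> \<otimes>\<^bsub>R Quot \<mm>\<^esub> inv\<^bsub>R Quot \<mm>\<^esub> c \<mm> = \<one>\<^bsub>R Quot \<mm>\<^esub>" by simp_all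
    qed
    have \<phi>e: "\<phi> (?e \<mm>) \<mm> \<in> carrier (R Quot \<mm>)" if "\<mm> \<in> \<omega>" for \<mm>
      using that dual_closed[OF \<phi>] by simp
    have u: "u \<in> carrier R\<omega>"
      unfolding u_def
    \<comment> \<open>The finiteness condition in the finitistic dual bounds the support of u: the
      unit vector at \<mm> has weight \<mm>, so where \<open>\<phi>\<close> kills that weight space
      \<open>u \<mm>\<close> vanishes.\<close>
    proof (rule orbit_sum_memI[OF _ _ dual_finite[OF \<phi>]])
      fix \<mm> assume m: "\<mm> \<in> \<omega>"
      interpret K: field "R Quot \<mm>" by (rule residue_field[OF m])
      show "inv\<^bsub>R Quot \<mm>\<^esub> c \<mm> \<otimes>\<^bsub>R Quot \<mm>\<^esub> \<phi> (?e \<mm>) \<mm> \<in> carrier (R Quot \<mm>)"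
        using inv \<phi>e m by simp
      assume "\<mm> \<notin> ?A"
      moreover have "?e \<mm> \<in> weight_space R \<sigma> t V \<mm>"
        using m orbit_subset_max_spec by (auto simp: weight_space_orbit_module single_apply)
      ultimately have "\<phi> (?e \<mm>) = \<zero>\<^bsub>R\<omega>\<^esub>" using m by blast
      then show "inv\<^bsub>R Quot \<mm>\<^esub> c \<mm> \<otimes>\<^bsub>R Quot \<mm>\<^esub> \<phi> (?e \<mm>) \<mm> = \<zero>\<^bsub>R Quot \<mm>\<^esub>"
        using inv m by simp
    qed
    have "form u w = \<phi> w" if w: "w \<in> carrier R\<omega>" for w
    proof (rule orbit_sum_eqI)
      fix \<mm> assume m: "\<mm> \<in> \<omega>"
      interpret K: field "R Quot \<mm>" by (rule residue_field[OF m])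
      have "form u w \<mm> = (c \<mm> \<otimes>\<^bsub>R Quot \<mm>\<^esub> inv\<^bsub>R Quot \<mm>\<^esub> c \<mm>) \<otimes>\<^bsub>R Quot \<mm>\<^esub>
          (\<phi> (?e \<mm>) \<mm> \<otimes>\<^bsub>R Quot \<mm>\<^esub> star ` w \<mm>)"
        using m w inv(1)[OF m] \<phi>e[OF m] by (simp add: form_apply u_def K.m_assoc)
      then show "form u w \<mm> = \<phi> w \<mm>"
        using inv(2)[OF m] \<phi>e[OF m] w m dual_apply[OF \<phi> w m] by simp
    qed (use w u \<phi> in \<open>simp_all add: form_closed dual_closed\<close>)
    then have "\<phi> = form_map u"
      using dual_extensional[OF \<phi>] by (intro extensionalityI[of _ "carrier R\<omega>"]) (auto simp: form_map_def)
    then show "\<phi> \<in> form_map ` carrier R\<omega>" using u by blast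
  qed (use form_map_dual in blast)
qed

text \<open>The action on the dual is defined by (X\<phi>)(w) = \<sigma>(\<phi>(Yw)) and its
  analogue for Y, so \<open>form_X\<close> and \<open>form_Y\<close>, read as identities in w, say
  that \<open>form_map\<close> intertwines the operators. For scalars, moving r to the second
  argument and back uses that star is an involution.\<close>

lemma finitistic_dual_isomorphic:
  "left_module_isomorphic (gwa R \<sigma> t) (finitistic_dual R star \<sigma> t \<omega> V) V"
  unfolding finitistic_dual_def orbit_module_simps
  \<comment> \<open>The target has to appear as a \<open>gwa_module\<close> for the transfer rule to
    match. This also unfolds the copy of V inside the dual, which is folded back in the remaining
    goals.\<close>
  unfolding orbit_module_def[of R \<sigma> t \<omega>]
proof ((rule left_module_isomorphic_gwa_module[OF orbit_eval_hyps, where \<Phi> = form_map]; (assumption)?),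
    unfold orbit_module_def[of R \<sigma> t \<omega>, symmetric], goal_cases)
  case 1
  show ?case using form_map_bij by simp
next
  case 2
  interpret M: module R R\<omega> by (rule orbit_sum_module)
  have "form \<zero>\<^bsub>R\<omega>\<^esub> w = \<zero>\<^bsub>R\<omega>\<^esub>" if "w \<in> carrier R\<omega>" for w
    using form_smult_left[OF zero_closed M.zero_closed that] form_closed[OF M.zero_closed that]
    by (simp add: M.smult_l_null)
  then show ?case by (simp add: form_map_def cong: restrict_cong)
next
  case (3 v w)
  then show ?case by (simp add: form_map_def form_add_left cong: restrict_cong)
next
  case (4 r v)
  interpret M: module R R\<omega> by (rule orbit_sum_module)
  from 4 show ?case
    by (simp add: form_map_def form_smult_left form_smult_right star_star cong: restrict_cong)
next
  case (5 v)
  then show ?case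
    by (simp add: form_map_def form_X orbit_sigma_inv_closed cong: restrict_cong)
next
  case (6 v)
  have "VX w \<in> carrier R\<omega>" if "w \<in> carrier R\<omega>" for w
    using that orbit_module_relations(1) by auto
  with 6 show ?case by (simp add: form_map_def form_Y cong: restrict_cong)
qed

end

theorem theorem5p2:
  fixes R :: "('r, 'x) ring_scheme" and star \<sigma> :: "'r \<Rightarrow> 'r" and t :: 'r
    and \<omega> :: "'r set set"
  assumes "gwa_datum R star \<sigma> t"
    and "\<omega> \<in> max_orbits R \<sigma>"
    and "infinite \<omega>"
    and "real_orbit star \<omega>"
    and "breaks t \<omega> = {}"
  shows "left_module_isomorphic (gwa R \<sigma> t)
      (finitistic_dual R star \<sigma> t \<omega> (orbit_module R \<sigma> t \<omega>)) (orbit_module R \<sigma> t \<omega>) \<and>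
    pseudo_unitarizable R star \<sigma> t \<omega> (orbit_module R \<sigma> t \<omega>)"
proof -
  interpret gwa_orbit R star \<sigma> t \<omega>
    using assms(1,2) by (intro gwa_orbit.intro gwa_orbit_axioms.intro)
  obtain c where "\<And>\<mm>. \<mm> \<in> \<omega> \<Longrightarrow> c \<mm> \<in> carrier (R Quot \<mm>) - {\<zero>\<^bsub>R Quot \<mm>\<^esub>}"
    and "\<And>\<mm>. \<mm> \<in> \<omega> \<Longrightarrow>
      c (\<sigma> ` \<mm>) \<otimes>\<^bsub>R Quot (\<sigma> ` \<mm>)\<^esub> (\<sigma> ` \<mm> +>\<^bsub>R\<^esub> \<sigma> t) = \<sigma> ` c \<mm>"
    using form_coefficients_exist[OF assms(3,5)] by blast
  then interpret gwa_orbit_form R star \<sigma> t \<omega> c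
    using assms(4) by unfold_locales auto
  show ?thesis using finitistic_dual_isomorphic orbit_module_pseudo_unitarizable by blast
qed

end
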